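(* For every positive integer $w$ there is a polynomial-time parsimonious equivalence between the problems Width$w$–Valency2–Maximal–Routing and IDS$w$–Subgroup–Distance. Here Width$w$–Valency2–Maximal–Routing is: given a polarised switching circuit $(G,T)$ with all in- and out-valencies at most $2$ and every class of $T$ of size at most $w$, and a positive integer $K$, decide whether there is a routing respecting $T$ whose associated cycle decomposition has at least $K$ cycles; and IDS$w$–Subgroup–Distance is: given $n$, $\pi\in S_n$, an integer $K$ and a set of involutions with disjoint support $\gamma_1,\dots,\gamma_t\in S_n$ of width at most $w$, decide whether some $\eta\in\langle\gamma_1,\dots,\gamma_t\rangle$ satisfies $d(\eta,\pi)\le K$.
   Context: A switching circuit is a finite directed graph $G=(V,E)$ (loops and multiple edges allowed) such that every vertex $v$ has equal in- and out-valency $\partial(v)$, together with, for every vertex $v$, bijective labellings of the edges into $v$ and of the edges out of $v$ by $\{1,\dots,\partial(v)\}$. A routing is a choice of $\rho(v)\in S_{\partial(v)}$ for each vertex $v$; it determines the permutation of $E$ sending an edge into $v$ with in-label $i$ to the edge out of $v$ with out-label $\rho(v)(i)$, whose cycles form a decomposition of $E$ into directed cycles. A polarisation $T$ is an equivalence relation on $V$ with equivalent vertices having equal valency; a routing respects $T$ if $\rho(x)=\rho(y)$ for $T$-equivalent $x,y$; the width of $T$ is its maximal class size. The Cayley distance is $d(\rho,\pi)=\min\{m:\rho\tau_1\cdots\tau_m=\pi,\ \tau_i\text{ transpositions}\}$, equal to $n$ minus the number of cycles of $\rho^{-1}\pi$. A set of involutions with disjoint support is a set of elements $\gamma_j=(x_j^{(1)}\,y_j^{(1)})\cdots(x_j^{(r_j)}\,y_j^{(r_j)})$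 with all points $x_j^{(i)},y_j^{(i)}$ distinct; its width is $\max_j r_j$. A parsimonious equivalence consists of polynomial-time transformations in each direction that preserve the answer and the number of solutions (routings respecting $T$ with at least $K$ cycles; elements $\eta$ of the subgroup within distance $K$ of $\pi$). *)

theory Defs
  imports
    "HOL-Algebra.Sym_Groups"
    "HOL-Algebra.Generated_Groups"
    "HOL-Combinatorics.Orbits"
    "HOL-Computational_Algebra.Polynomial"
begin

section \<open>Switching circuits, routings, polarisations\<close>

record ('v, 'e) circuit =
  verts :: "'v set"
  edges :: "'e set"
  tail :: "'e \<Rightarrow> 'v"
  head :: "'e \<Rightarrow> 'v"
  out_label :: "'e \<Rightarrow> nat"
  in_label :: "'e \<Rightarrow> nat"

definition in_edges :: "('v, 'e) circuit \<Rightarrow> 'v \<Rightarrow> 'e set" where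
  "in_edges G v = {e \<in> edges G. head G e = v}"

definition out_edges :: "('v, 'e) circuit \<Rightarrow> 'v \<Rightarrow> 'e set" where
  "out_edges G v = {e \<in> edges G. tail G e = v}"

text \<open>In a switching circuit the in- and out-valency agree, so the in-valency serves
  as the valency.\<close>

definition valency :: "('v, 'e) circuit \<Rightarrow> 'v \<Rightarrow> nat" where
  "valency G v = card (in_edges G v)"

definition switching_circuit :: "('v, 'e) circuit \<Rightarrow> bool" where
  "switching_circuit G \<longleftrightarrow>
     finite (verts G) \<and> finite (edges G) \<and>
     (\<forall>e\<in>edges G. tail G e \<in> verts G \<and> head G e \<in> verts G) \<and>
     (\<forall>v\<in>verts G.
        card (in_edges G v) = card (out_edges G v) \<and>
        bij_betw (in_label G) (in_edges G v) {1..valency G v} \<and>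
        bij_betw (out_label G) (out_edges G v) {1..valency G v})"

text \<open>Routings are extensional functions on the vertex set, so that the set of routings
  has the intended cardinality.\<close>

definition routings :: "('v, 'e) circuit \<Rightarrow> ('v \<Rightarrow> nat \<Rightarrow> nat) set" where
  "routings G = (\<Pi>\<^sub>E v\<in>verts G. {p. p permutes {1..valency G v}})"

definition routing_perm :: "('v, 'e) circuit \<Rightarrow> ('v \<Rightarrow> nat \<Rightarrow> nat) \<Rightarrow> 'e \<Rightarrow> 'e" where
  "routing_perm G \<rho> e =
     (if e \<in> edges G
      then (THE e'. e' \<in> out_edges G (head G e) \<and>
                    out_label G e' = \<rho> (head G e) (in_label G e))
      else e)"

definition routing_cycles :: "('v, 'e) circuit \<Rightarrow> ('v \<Rightarrow> nat \<Rightarrow> nat) \<Rightarrow> 'e set set" where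
  "routing_cycles G \<rho> = orbit (routing_perm G \<rho>) ` edges G"

definition polarisation :: "('v, 'e) circuit \<Rightarrow> ('v \<times> 'v) set \<Rightarrow> bool" where
  "polarisation G T \<longleftrightarrow>
     equiv (verts G) T \<and> (\<forall>(x, y)\<in>T. valency G x = valency G y)"

definition respects_polarisation :: "('v \<times> 'v) set \<Rightarrow> ('v \<Rightarrow> nat \<Rightarrow> nat) \<Rightarrow> bool" where
  "respects_polarisation T \<rho> \<longleftrightarrow> (\<forall>(x, y)\<in>T. \<rho> x = \<rho> y)"


section \<open>Cayley distance and involutions with disjoint support\<close>

definition transpositions :: "nat \<Rightarrow> (nat \<Rightarrow> nat) set" where
  "transpositions n = {transpose a b | a b. a \<in> {1..n} \<and> b \<in> {1..n} \<and> a \<noteq> b}"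

definition cayley_dist :: "nat \<Rightarrow> (nat \<Rightarrow> nat) \<Rightarrow> (nat \<Rightarrow> nat) \<Rightarrow> nat" where
  "cayley_dist n \<rho> \<pi> =
     (LEAST m. \<exists>\<tau>s. length \<tau>s = m \<and> set \<tau>s \<subseteq> transpositions n \<and>
                   \<rho> \<circ> foldr (\<circ>) \<tau>s id = \<pi>)"

text \<open>An involution is given by the list of its 2-cycles.\<close>

definition involution_of :: "(nat \<times> nat) list \<Rightarrow> nat \<Rightarrow> nat" where
  "involution_of ps = foldr (\<lambda>(x, y) p. transpose x y \<circ> p) ps id"

definition disjoint_involutions :: "nat \<Rightarrow> (nat \<times> nat) list list \<Rightarrow> bool" where
  "disjoint_involutions n \<gamma>s \<longleftrightarrow>
     [] \<notin> set \<gamma>s \<and>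
     distinct (concat (map (\<lambda>(x, y). [x, y]) (concat \<gamma>s))) \<and>
     set (concat (map (\<lambda>(x, y). [x, y]) (concat \<gamma>s))) \<subseteq> {1..n}"


section \<open>Polynomial-time computation\<close>

text \<open>
  The model of computation is Jones's language WHILE: structured programs whose variables
  hold binary trees. Evaluating an expression costs the sum of the sizes of the values of
  all its subexpressions, so that no sharing of subtrees is presupposed and a run of cost
  \<open>t\<close> cannot assign a value of size greater than \<open>t\<close>. Under this cost measure WHILE
  programs and Turing machines simulate each other with polynomial overhead.
\<close>

datatype tree = Tip | Node tree tree

fun tree_size :: "tree \<Rightarrow> nat" where
  "tree_size Tip = 1"
| "tree_size (Node l r) = 1 + tree_size l + tree_size r"

datatype expr =
    Var nat
  | TipE
  | NodeE expr expr
  | LeftE expr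
  | RightE expr
  | EqualE expr expr

type_synonym store = "nat \<Rightarrow> tree"

fun left :: "tree \<Rightarrow> tree" where
  "left Tip = Tip"
| "left (Node l r) = l"

fun right :: "tree \<Rightarrow> tree" where
  "right Tip = Tip"
| "right (Node l r) = r"

fun val :: "expr \<Rightarrow> store \<Rightarrow> tree" where
  "val (Var x) s = s x"
| "val TipE s = Tip"
| "val (NodeE a b) s = Node (val a s) (val b s)"
| "val (LeftE a) s = left (val a s)"
| "val (RightE a) s = right (val a s)"
| "val (EqualE a b) s = (if val a s = val b s then Node Tip Tip else Tip)"

fun cost :: "expr \<Rightarrow> store \<Rightarrow> nat" where
  "cost (Var x) s = tree_size (s x)"
| "cost TipE s = 1"
| "cost (NodeE a b) s = tree_size (val (NodeE a b) s) + cost a s + cost b s"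
| "cost (LeftE a) s = tree_size (val (LeftE a) s) + cost a s"
| "cost (RightE a) s = tree_size (val (RightE a) s) + cost a s"
| "cost (EqualE a b) s = tree_size (val (EqualE a b) s) + cost a s + cost b s"

datatype prog =
    Skip
  | Assign nat expr
  | Seq prog prog
  | If expr prog prog
  | While expr prog

text \<open>\<open>exec c s t s'\<close>: program \<open>c\<close>, started in store \<open>s\<close>, terminates in store \<open>s'\<close> at
  total cost \<open>t\<close>. In guards, \<open>Tip\<close> means false and every other tree means true.\<close>

inductive exec :: "prog \<Rightarrow> store \<Rightarrow> nat \<Rightarrow> store \<Rightarrow> bool" where
  Skip: "exec Skip s 1 s"
| Assign: "exec (Assign x a) s (cost a s) (s(x := val a s))"
| Seq: "exec c s t s' \<Longrightarrow> exec d s' u s'' \<Longrightarrow> exec (Seq c d) s (t + u) s''"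
| IfTrue: "val b s \<noteq> Tip \<Longrightarrow> exec c s t s' \<Longrightarrow> exec (If b c d) s (cost b s + t) s'"
| IfFalse: "val b s = Tip \<Longrightarrow> exec d s t s' \<Longrightarrow> exec (If b c d) s (cost b s + t) s'"
| WhileFalse: "val b s = Tip \<Longrightarrow> exec (While b c) s (cost b s) s"
| WhileTrue: "val b s \<noteq> Tip \<Longrightarrow> exec c s t s' \<Longrightarrow> exec (While b c) s' u s'' \<Longrightarrow>
    exec (While b c) s (cost b s + t + u) s''"

lemma exec_deterministic:
  "exec c s t s' \<Longrightarrow> exec c s u s'' \<Longrightarrow> u = t \<and> s'' = s'"
proof (induction arbitrary: u s'' rule: exec.induct)
  case (Seq c s t s' d u s'')
  from Seq.prems show ?case by (cases rule: exec.cases) (use Seq.IH in blast)+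
next
  case (WhileTrue b s c t s' u s'')
  from WhileTrue.prems show ?case
    by (cases rule: exec.cases) (use WhileTrue.hyps WhileTrue.IH in blast)+
qed (erule exec.cases; auto)+

text \<open>Variable 0 holds the input and the output; all other variables start as \<open>Tip\<close>.\<close>

definition poly_time_on ::
  "'i set \<Rightarrow> ('i \<Rightarrow> tree) \<Rightarrow> ('j \<Rightarrow> tree) \<Rightarrow> ('i \<Rightarrow> 'j) \<Rightarrow> bool" where
  "poly_time_on A enc enc' f \<longleftrightarrow>
     (\<exists>c (p :: nat poly). \<forall>x\<in>A. \<exists>t s.
        exec c ((\<lambda>_. Tip)(0 := enc x)) t s \<and>
        s 0 = enc' (f x) \<and>
        t \<le> poly p (tree_size (enc x)))"


section \<open>Problems and parsimonious equivalence\<close>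

text \<open>The decision problem attached to a \<open>problem\<close> asks whether an instance has a
  solution; the counting problem asks for the number of solutions.\<close>

record ('i, 's) problem =
  instances :: "'i set"
  encode :: "'i \<Rightarrow> tree"
  solutions :: "'i \<Rightarrow> 's set"

definition parsimonious_reduction ::
  "('i, 's) problem \<Rightarrow> ('j, 'r) problem \<Rightarrow> ('i \<Rightarrow> 'j) \<Rightarrow> bool" where
  "parsimonious_reduction P Q f \<longleftrightarrow>
     poly_time_on (instances P) (encode P) (encode Q) f \<and>
     (\<forall>x\<in>instances P.
        f x \<in> instances Q \<and>
        (solutions P x \<noteq> {} \<longleftrightarrow> solutions Q (f x) \<noteq> {}) \<and>
        card (solutions P x) = card (solutions Q (f x)))"

definition parsimoniously_equivalent ::
  "('i, 's) problem \<Rightarrow> ('j, 'r) problem \<Rightarrow> bool" where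
  "parsimoniously_equivalent P Q \<longleftrightarrow>
     (\<exists>f. parsimonious_reduction P Q f) \<and> (\<exists>g. parsimonious_reduction Q P g)"


section \<open>Encodings\<close>

text \<open>Numbers are encoded in binary, least significant digit first.\<close>

definition enc_bool :: "bool \<Rightarrow> tree" where
  "enc_bool b = (if b then Node Tip Tip else Tip)"

fun enc_nat :: "nat \<Rightarrow> tree" where
  "enc_nat n = (if n = 0 then Tip else Node (enc_bool (odd n)) (enc_nat (n div 2)))"

declare enc_nat.simps [simp del]

definition enc_int :: "int \<Rightarrow> tree" where
  "enc_int i = Node (enc_bool (i < 0)) (enc_nat (nat \<bar>i\<bar>))"

fun enc_pair :: "('a \<Rightarrow> tree) \<Rightarrow> ('b \<Rightarrow> tree) \<Rightarrow> 'a \<times> 'b \<Rightarrow> tree" where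
  "enc_pair f g (a, b) = Node (f a) (g b)"

fun enc_list :: "('a \<Rightarrow> tree) \<Rightarrow> 'a list \<Rightarrow> tree" where
  "enc_list f [] = Tip"
| "enc_list f (x # xs) = Node (f x) (enc_list f xs)"

lemma inj_enc_bool: "inj enc_bool"
  by (auto simp: inj_def enc_bool_def split: if_splits)

lemma inj_enc_nat: "inj enc_nat"
proof (rule injI)
  fix m n
  show "enc_nat m = enc_nat n \<Longrightarrow> m = n"
  proof (induction m arbitrary: n rule: less_induct)
    case (less m)
    show ?case
    proof (cases "m = 0 \<or> n = 0")
      case True
      then show ?thesis
        using less.prems enc_nat.simps[of m] enc_nat.simps[of n] by (auto split: if_splits)
    next
      case False
      then have "enc_bool (odd m) = enc_bool (odd n)" "enc_nat (m div 2) = enc_nat (n div 2)"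
        using less.prems enc_nat.simps[of m] enc_nat.simps[of n] by simp_all
      then have "odd m = odd n" "m div 2 = n div 2"
        using inj_enc_bool False less.IH[of "m div 2"] by (auto dest: injD)
      then show ?thesis
        by (metis even_two_times_div_two odd_two_times_div_two_succ)
    qed
  qed
qed

lemma inj_enc_int: "inj enc_int"
  by (rule injI) (auto simp: enc_int_def dest!: injD[OF inj_enc_bool] injD[OF inj_enc_nat])

lemma inj_enc_pair: "inj f \<Longrightarrow> inj g \<Longrightarrow> inj (enc_pair f g)"
  by (auto simp: inj_def)

lemma inj_enc_list:
  assumes "inj f" shows "inj (enc_list f)"
proof (rule injI)
  fix xs ys
  show "enc_list f xs = enc_list f ys \<Longrightarrow> xs = ys"
  proof (induction xs arbitrary: ys)
    case Nil then show ?case by (cases ys) auto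
  next
    case (Cons x xs) then show ?case using assms by (cases ys) (auto dest: injD)
  qed
qed


section \<open>Maximal routing\<close>

text \<open>A polarised circuit is presented by the list of the classes of \<open>T\<close>, each class a list
  of vertices, and the list of edges, each edge \<open>(u, i, v, j)\<close> going from \<open>u\<close>, with
  out-label \<open>i\<close>, to \<open>v\<close>, with in-label \<open>j\<close>. Edges are identified by their list positions,
  so that loops and multiple edges are possible.\<close>

record routing_instance =
  ri_classes :: "nat list list"
  ri_arcs :: "(nat \<times> nat \<times> nat \<times> nat) list"
  ri_bound :: nat

definition ri_circuit :: "routing_instance \<Rightarrow> (nat, nat) circuit" where
  "ri_circuit I =
     \<lparr> verts = set (concat (ri_classes I)),
       edges = {..<length (ri_arcs I)},
       tail = (\<lambda>e. case ri_arcs I ! e of (u, i, v, j) \<Rightarrow> u),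
       head = (\<lambda>e. case ri_arcs I ! e of (u, i, v, j) \<Rightarrow> v),
       out_label = (\<lambda>e. case ri_arcs I ! e of (u, i, v, j) \<Rightarrow> i),
       in_label = (\<lambda>e. case ri_arcs I ! e of (u, i, v, j) \<Rightarrow> j) \<rparr>"

definition ri_polarisation :: "routing_instance \<Rightarrow> (nat \<times> nat) set" where
  "ri_polarisation I = (\<Union>C\<in>set (ri_classes I). set C \<times> set C)"

definition enc_routing_instance :: "routing_instance \<Rightarrow> tree" where
  "enc_routing_instance I =
     Node (enc_list (enc_list enc_nat) (ri_classes I))
       (Node (enc_list (enc_pair enc_nat (enc_pair enc_nat (enc_pair enc_nat enc_nat))) (ri_arcs I))
         (enc_nat (ri_bound I)))"

lemma inj_enc_routing_instance: "inj enc_routing_instance"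
  by (rule injI)
    (auto simp: enc_routing_instance_def intro!: routing_instance.equality
      dest!: injD[OF inj_enc_nat]
        injD[OF inj_enc_list[OF inj_enc_list[OF inj_enc_nat]]]
        injD[OF inj_enc_list[OF inj_enc_pair[OF inj_enc_nat
          inj_enc_pair[OF inj_enc_nat inj_enc_pair[OF inj_enc_nat inj_enc_nat]]]]])

definition valency2_maximal_routing ::
  "nat \<Rightarrow> (routing_instance, nat \<Rightarrow> nat \<Rightarrow> nat) problem" where
  "valency2_maximal_routing w =
     \<lparr> instances =
         {I. distinct (concat (ri_classes I)) \<and> [] \<notin> set (ri_classes I) \<and>
             switching_circuit (ri_circuit I) \<and>
             polarisation (ri_circuit I) (ri_polarisation I) \<and>
             (\<forall>v\<in>verts (ri_circuit I). valency (ri_circuit I) v \<le> 2) \<and>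
             (\<forall>C\<in>verts (ri_circuit I) // ri_polarisation I. card C \<le> w) \<and>
             ri_bound I > 0},
       encode = enc_routing_instance,
       solutions = (\<lambda>I.
         {\<rho> \<in> routings (ri_circuit I).
            respects_polarisation (ri_polarisation I) \<rho> \<and>
            card (routing_cycles (ri_circuit I) \<rho>) \<ge> ri_bound I}) \<rparr>"


section \<open>Subgroup distance\<close>

text \<open>The permutation \<open>\<pi>\<close> is presented by the list \<open>[\<pi> 1, \<dots>, \<pi> n]\<close>.\<close>

record distance_instance =
  di_degree :: nat
  di_images :: "nat list"
  di_gens :: "(nat \<times> nat) list list"
  di_bound :: int

definition di_perm :: "distance_instance \<Rightarrow> nat \<Rightarrow> nat" where
  "di_perm J i = (if i \<in> {1..di_degree J} then di_images J ! (i - 1) else i)"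

definition enc_distance_instance :: "distance_instance \<Rightarrow> tree" where
  "enc_distance_instance J =
     Node (enc_nat (di_degree J))
       (Node (enc_list enc_nat (di_images J))
         (Node (enc_list (enc_list (enc_pair enc_nat enc_nat)) (di_gens J))
           (enc_int (di_bound J))))"

lemma inj_enc_distance_instance: "inj enc_distance_instance"
  by (rule injI)
    (auto simp: enc_distance_instance_def intro!: distance_instance.equality
      dest!: injD[OF inj_enc_nat] injD[OF inj_enc_int] injD[OF inj_enc_list[OF inj_enc_nat]]
        injD[OF inj_enc_list[OF inj_enc_list[OF inj_enc_pair[OF inj_enc_nat inj_enc_nat]]]])

definition ids_subgroup_distance ::
  "nat \<Rightarrow> (distance_instance, nat \<Rightarrow> nat) problem" where
  "ids_subgroup_distance w =
     \<lparr> instances =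
         {J. length (di_images J) = di_degree J \<and>
             di_perm J permutes {1..di_degree J} \<and>
             disjoint_involutions (di_degree J) (di_gens J) \<and>
             (\<forall>\<gamma>\<in>set (di_gens J). length \<gamma> \<le> w)},
       encode = enc_distance_instance,
       solutions = (\<lambda>J.
         {\<eta> \<in> generate (sym_group (di_degree J)) (involution_of ` set (di_gens J)).
            int (cayley_dist (di_degree J) \<eta> (di_perm J)) \<le> di_bound J}) \<rparr>"

end

theory Submission
  imports Defs
begin

text \<open>
  Number the edges of a circuit by points. Routing every vertex straight is a permutation \<open>\<pi>\<close> of
  the points, and swapping at all vertices of a class composes \<open>\<pi>\<close> with the involution that
  exchanges the two outgoing edges of each of these vertices. So the routings respecting \<open>T\<close>
  correspond to the products \<open>\<eta>\<close> of a set of disjoint involutions, and the routing belonging to \<open>\<eta>\<close>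
  has the cycles of \<open>\<eta> \<circ> \<pi>\<close>, of which there are \<open>n\<close> minus the distance of \<open>\<eta>\<close> and \<open>\<pi>\<close>. Conversely,
  each pair of a given involution becomes a vertex of valency 2 and each remaining point a vertex
  of valency 1.

  For the time bound, a notion of polynomial-time function with clean scratch variables is closed
  under composition, pairing, case distinction and iteration over a list whose intermediate
  results stay of polynomial size. Both reductions are built from these operations.
\<close>

section \<open>Functions computable in polynomial time\<close>

text \<open>The distance from \<open>\<eta>\<close> to \<open>\<pi>\<close> is governed by the
  cycles of the inverse of \<open>\<eta>\<close> composed with \<open>\<pi>\<close>. A product of
  disjoint involutions is its own inverse, so this permutation is
  \<open>\<eta> \<circ> \<pi>\<close>, which is also what a circuit computes: first follow
  \<open>\<pi>\<close>, then exchange outgoing edges. Both solution sets are injective images of the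
  same family of subsets of the generators, so existence and number of solutions are settled
  together. Two obstacles shape the algorithmic half. The polynomial-time notion ranges over all
  values of a type and not only over valid instances; so the constructions are total and of
  polynomial size on malformed input too: lookups go through a total search, and
  \<open>to_routing\<close> measures the list of images, since outside valid instances nothing ties
  it to the binary number \<open>di_degree\<close>. Moreover bounds are written in binary and may be
  exponentially large in the input size, so no loop may run as often as the value of a number says;
  every loop runs along a list.\<close>

lemma poly_nat_mono:
  fixes p :: "nat poly"
  assumes "m \<le> n" shows "poly p m \<le> poly p n"
proof (induction p)
  case (pCons a p)
  then show ?case using assms by (simp add: mult_le_mono)
qed simp

lemma tree_size_pos [simp]: "0 < tree_size t"
  by (cases t) auto

lemma tree_size_left_right: "tree_size (left t) \<le> tree_size t" "tree_size (right t) \<le> tree_size t"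
  by (cases t; simp)+

lemma tree_size_val_le_cost: "tree_size (val e s) \<le> cost e s"
  by (cases e) auto

text \<open>Only assignments enlarge a variable, and an assignment costs at least the size of the
  value it stores. This turns time bounds into size bounds.\<close>

lemma exec_size: "exec c s t s' \<Longrightarrow> tree_size (s' i) \<le> tree_size (s i) + t"
proof (induction rule: exec.induct)
  case (Assign x a s)
  then show ?case using tree_size_val_le_cost[of a s] by simp
qed auto

text \<open>An upper bound instead of the exact cost, so that bounds can be added and weakened
  freely.\<close>

definition runs :: "prog \<Rightarrow> store \<Rightarrow> nat \<Rightarrow> store \<Rightarrow> bool" where
  "runs c s B s' \<longleftrightarrow> (\<exists>t\<le>B. exec c s t s')"

lemma runs_Assign: "cost a s \<le> B \<Longrightarrow> s' = s(x := val a s) \<Longrightarrow> runs (Assign x a) s B s'"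
  unfolding runs_def using exec.Assign by blast

lemma runs_Seq: "runs c s A s' \<Longrightarrow> runs d s' B s'' \<Longrightarrow> runs (Seq c d) s (A + B) s''"
  unfolding runs_def by (meson add_mono exec.Seq)

lemma runs_If:
  "cost b s \<le> A \<Longrightarrow> (val b s \<noteq> Tip \<Longrightarrow> runs c s B s') \<Longrightarrow> (val b s = Tip \<Longrightarrow> runs d s B s') \<Longrightarrow>
    runs (If b c d) s (A + B) s'"
  unfolding runs_def by (cases "val b s = Tip") (meson add_mono exec.IfTrue exec.IfFalse)+

lemma runs_WhileFalse: "val b s = Tip \<Longrightarrow> cost b s \<le> B \<Longrightarrow> runs (While b c) s B s"
  unfolding runs_def using exec.WhileFalse by blast

lemma runs_WhileTrue:
  "val b s \<noteq> Tip \<Longrightarrow> cost b s \<le> A \<Longrightarrow> runs c s B s' \<Longrightarrow> runs (While b c) s' C s'' \<Longrightarrow>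
    runs (While b c) s (A + B + C) s''"
  unfolding runs_def by (meson add_mono exec.WhileTrue)

lemma runs_mono: "runs c s A s' \<Longrightarrow> A \<le> B \<Longrightarrow> runs c s B s'"
  unfolding runs_def by (meson order_trans)

lemma runs_cong: "runs c s A s' \<Longrightarrow> s' = s'' \<Longrightarrow> runs c s A s''"
  by simp

definition clean :: "nat \<Rightarrow> store \<Rightarrow> bool" where
  "clean m s \<longleftrightarrow> (\<forall>i. 0 < i \<and> i < m \<longrightarrow> s i = Tip)"

text \<open>Restoring the scratch variables below \<open>m\<close> and never touching the others makes programs
  composable without any renaming of variables.\<close>

definition computes :: "prog \<Rightarrow> nat \<Rightarrow> nat poly \<Rightarrow> ('a \<Rightarrow> tree) \<Rightarrow> ('b \<Rightarrow> tree) \<Rightarrow> ('a \<Rightarrow> 'b) \<Rightarrow> bool" where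
  "computes c m p ea eb f \<longleftrightarrow>
     (\<forall>x s. s 0 = ea x \<longrightarrow> clean m s \<longrightarrow> runs c s (poly p (tree_size (ea x))) (s(0 := eb (f x))))"

definition polytime :: "('a \<Rightarrow> tree) \<Rightarrow> ('b \<Rightarrow> tree) \<Rightarrow> ('a \<Rightarrow> 'b) \<Rightarrow> bool" where
  "polytime ea eb f \<longleftrightarrow> (\<exists>c m p. computes c m p ea eb f)"

lemma clean_mono: "clean n s \<Longrightarrow> m \<le> n \<Longrightarrow> clean m s"
  unfolding clean_def by auto

lemma clean_upd: "clean m s \<Longrightarrow> i = 0 \<or> m \<le> i \<or> v = Tip \<Longrightarrow> clean m (s(i := v))"
  unfolding clean_def by auto

lemma computesD:
  assumes "computes c m p ea eb f" "s 0 = ea x" "clean m s"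
  shows "runs c s (poly p (tree_size (ea x))) (s(0 := eb (f x)))"
  using assms unfolding computes_def by blast

lemma poly_time_on_polytime:
  assumes "polytime ea eb f" shows "poly_time_on A ea eb f"
proof -
  obtain c m p where c: "computes c m p ea eb f" using assms unfolding polytime_def by blast
  show ?thesis unfolding poly_time_on_def
  proof (rule exI[of _ c], rule exI[of _ p], rule ballI)
    fix x
    let ?s = "(\<lambda>_. Tip)(0 := ea x) :: store"
    have "runs c ?s (poly p (tree_size (ea x))) (?s(0 := eb (f x)))"
      using computesD[OF c, of ?s x] by (simp add: clean_def)
    then obtain t where "t \<le> poly p (tree_size (ea x))" "exec c ?s t (?s(0 := eb (f x)))"
      unfolding runs_def by blast
    then show "\<exists>t s. exec c ?s t s \<and> s 0 = eb (f x) \<and> t \<le> poly p (tree_size (ea x))"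
      by (intro exI[of _ t] exI[of _ "?s(0 := eb (f x))"]) simp
  qed
qed

lemma polytime_size:
  assumes "polytime ea eb f"
  obtains p where "\<And>x. tree_size (eb (f x)) \<le> poly p (tree_size (ea x))"
proof -
  obtain c m p where c: "computes c m p ea eb f" using assms unfolding polytime_def by blast
  \<comment> \<open>The summand \<open>[:0, 1:]\<close> is the size of the input, which variable 0
    holds at the start of the run.\<close>
  have "tree_size (eb (f x)) \<le> poly (p + [:0, 1:]) (tree_size (ea x))" for x
  proof -
    let ?s = "(\<lambda>_. Tip)(0 := ea x) :: store"
    have "runs c ?s (poly p (tree_size (ea x))) (?s(0 := eb (f x)))"
      using computesD[OF c, of ?s x] by (simp add: clean_def)
    then obtain t where "t \<le> poly p (tree_size (ea x))" "exec c ?s t (?s(0 := eb (f x)))"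
      unfolding runs_def by blast
    from exec_size[OF this(2), of 0] this(1) show ?thesis by simp
  qed
  then show ?thesis using that by blast
qed

text \<open>A program sees only trees. So a record or a number may be replaced by any value with the
  same encoding, such as a nested pair or a list of digits, without changing the program.\<close>

lemma polytime_cong:
  assumes "polytime ea eb f" "\<And>x. eb' (g x) = eb (f x)"
  shows "polytime ea eb' g"
  using assms unfolding polytime_def computes_def by auto

lemma polytime_dom_cong:
  assumes "polytime ea eb f" "\<And>x. ea' x = ea (h x)"
  shows "polytime ea' eb (\<lambda>x. f (h x))"
  using assms unfolding polytime_def computes_def by metis

lemma polytime_id: "polytime e e (\<lambda>x. x)"
proof -
  have "computes (Assign 0 (Var 0)) 0 [:0, 1:] e e (\<lambda>x. x)"
    unfolding computes_def by (auto intro!: runs_Assign)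
  then show ?thesis unfolding polytime_def by blast
qed

text \<open>The second program is timed by the size of the intermediate result; that size is bounded
  by a polynomial \<open>r\<close> in the input, and polynomials over \<open>nat\<close> are
  monotone, whence \<open>pcompose q r\<close>.\<close>

lemma polytime_comp:
  assumes "polytime ea eb f" "polytime eb ec g"
  shows "polytime ea ec (\<lambda>x. g (f x))"
proof -
  obtain c m p where c: "computes c m p ea eb f" using assms(1) unfolding polytime_def by blast
  obtain d n q where d: "computes d n q eb ec g" using assms(2) unfolding polytime_def by blast
  obtain r where r: "\<And>x. tree_size (eb (f x)) \<le> poly r (tree_size (ea x))"
    using polytime_size[OF assms(1)] by blast
  have "computes (Seq c d) (max m n) (p + pcompose q r) ea ec (\<lambda>x. g (f x))"
    unfolding computes_def
  proof (intro allI impI)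
    fix x s assume s: "s 0 = ea x" "clean (max m n) s"
    then have cl: "clean m s" "clean n s" by (auto elim: clean_mono)
    let ?s = "s(0 := eb (f x))"
    have "runs d ?s (poly q (tree_size (eb (f x)))) (?s(0 := ec (g (f x))))"
      by (rule computesD[OF d]) (simp_all add: clean_upd cl)
    then have "runs d ?s (poly (pcompose q r) (tree_size (ea x))) (?s(0 := ec (g (f x))))"
      by (rule runs_mono) (simp add: poly_pcompose poly_nat_mono r)
    with computesD[OF c s(1) cl(1)]
    show "runs (Seq c d) s (poly (p + pcompose q r) (tree_size (ea x))) (s(0 := ec (g (f x))))"
      using runs_Seq by fastforce
  qed
  then show ?thesis unfolding polytime_def by blast
qed

fun quote_tree :: "tree \<Rightarrow> expr" where
  "quote_tree Tip = TipE"
| "quote_tree (Node l r) = NodeE (quote_tree l) (quote_tree r)"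

lemma val_quote_tree [simp]: "val (quote_tree t) s = t"
  by (induction t) auto

lemma cost_quote_tree: "cost (quote_tree t) s = cost (quote_tree t) s'"
  by (induction t) auto

lemma polytime_const: "polytime ea eb (\<lambda>_. c)"
proof -
  have "computes (Assign 0 (quote_tree (eb c))) 0 [:cost (quote_tree (eb c)) (\<lambda>_. Tip):] ea eb (\<lambda>_. c)"
    unfolding computes_def using eq_imp_le[OF cost_quote_tree] by (auto intro!: runs_Assign)
  then show ?thesis unfolding polytime_def by blast
qed

text \<open>Both programs read variable 0, so the input is saved in \<open>k\<close> and the first
  result in \<open>Suc k\<close>, above the scratch variables of either program; both are reset
  afterwards to keep the store clean.\<close>

lemma polytime_pair:
  assumes "polytime ea eb f" "polytime ea ec g"
  shows "polytime ea (enc_pair eb ec) (\<lambda>x. (f x, g x))"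
proof -
  obtain c m p where c: "computes c m p ea eb f" using assms(1) unfolding polytime_def by blast
  obtain d n q where d: "computes d n q ea ec g" using assms(2) unfolding polytime_def by blast
  obtain r where r: "\<And>x. tree_size (eb (f x)) \<le> poly r (tree_size (ea x))"
    using polytime_size[OF assms(1)] by blast
  obtain u where u: "\<And>x. tree_size (ec (g x)) \<le> poly u (tree_size (ea x))"
    using polytime_size[OF assms(2)] by blast
  \<comment> \<open>\<open>Suc\<close> keeps \<open>k\<close> different from variable 0 even if
    \<open>m = n = 0\<close>.\<close>
  define k where "k = Suc (max m n)"
  let ?P = "Seq (Assign k (Var 0)) (Seq c (Seq (Assign (Suc k) (Var 0)) (Seq (Assign 0 (Var k))
     (Seq (Assign k TipE) (Seq d (Seq (Assign 0 (NodeE (Var (Suc k)) (Var 0))) (Assign (Suc k) TipE)))))))"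
  have "computes ?P (Suc (Suc k)) ([:3, 2:] + p + r + q + smult 2 (r + u)) ea (enc_pair eb ec) (\<lambda>x. (f x, g x))"
    unfolding computes_def
  proof (intro allI impI)
    fix x s assume s0: "s 0 = ea x" and cl0: "clean (Suc (Suc k)) s"
    have k: "k \<noteq> 0" "m \<le> k" "n \<le> k" by (auto simp: k_def)
    then have cl: "clean m s" "clean n s" and sk: "s k = Tip" "s (Suc k) = Tip"
      using cl0 by (auto elim: clean_mono) (auto simp: clean_def)
    let ?N = "tree_size (ea x)"
    let ?s1 = "s(k := ea x)"
    let ?s2 = "?s1(0 := eb (f x))"
    let ?s3 = "?s2(Suc k := eb (f x))"
    let ?s4 = "?s3(0 := ea x)"
    let ?s5 = "?s4(k := Tip)"
    let ?s6 = "?s5(0 := ec (g x))"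
    let ?s7 = "?s6(0 := Node (eb (f x)) (ec (g x)))"
    have 2: "runs c ?s1 (poly p ?N) ?s2"
      by (rule computesD[OF c]) (use k s0 cl in \<open>auto intro!: clean_upd\<close>)
    have 6: "runs d ?s5 (poly q ?N) ?s6"
      by (rule computesD[OF d]) (use k s0 cl in \<open>auto intro!: clean_upd\<close>)
    have "runs ?P s (?N + (poly p ?N + (poly r ?N + (?N + (1 + (poly q ?N +
        ((1 + 2 * (poly r ?N + poly u ?N)) + 1))))))) (?s7(Suc k := Tip))"
      apply (rule runs_Seq[where s'="?s1"], rule runs_Assign, use s0 k in simp, use s0 in simp)
      apply (rule runs_Seq[OF 2])
      apply (rule runs_Seq[where s'="?s3"], rule runs_Assign, use k r in simp, use s0 k in simp)
      apply (rule runs_Seq[where s'="?s4"], rule runs_Assign, use k in simp, use s0 k in simp)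
      apply (rule runs_Seq[where s'="?s5"], rule runs_Assign, use k in simp, use s0 k in simp)
      apply (rule runs_Seq[OF 6])
      apply (rule runs_Seq[where s'="?s7"], rule runs_Assign)
        apply (use k r[of x] u[of x] in simp)
       apply (use s0 k in simp)
      apply (rule runs_Assign; simp)
      done
    moreover have "?s7(Suc k := Tip) = s(0 := enc_pair eb ec (f x, g x))"
      using k sk by auto
    ultimately show "runs ?P s (poly ([:3, 2:] + p + r + q + smult 2 (r + u)) ?N)
        (s(0 := enc_pair eb ec (f x, g x)))"
      by (auto elim!: runs_mono simp: algebra_simps)
  qed
  then show ?thesis unfolding polytime_def by blast
qed

lemma polytime_LeftE:
  assumes "\<And>x. left (ea x) = eb (f x)" shows "polytime ea eb f"
proof -
  have "computes (Assign 0 (LeftE (Var 0))) 0 [:0, 2:] ea eb f"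
    unfolding computes_def
    using assms tree_size_left_right(1)[of "ea _"] by (auto intro!: runs_Assign)
  then show ?thesis unfolding polytime_def by blast
qed

lemma polytime_RightE:
  assumes "\<And>x. right (ea x) = eb (f x)" shows "polytime ea eb f"
proof -
  have "computes (Assign 0 (RightE (Var 0))) 0 [:0, 2:] ea eb f"
    unfolding computes_def
    using assms tree_size_left_right(2)[of "ea _"] by (auto intro!: runs_Assign)
  then show ?thesis unfolding polytime_def by blast
qed

lemma polytime_fst:
  assumes "polytime e (enc_pair ea eb) f" shows "polytime e ea (\<lambda>x. fst (f x))"
  by (rule polytime_comp[OF assms], rule polytime_LeftE) auto

lemma polytime_snd:
  assumes "polytime e (enc_pair ea eb) f" shows "polytime e eb (\<lambda>x. snd (f x))"
  by (rule polytime_comp[OF assms], rule polytime_RightE) auto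

text \<open>\<open>EqualE\<close> compares trees; injectivity of the encoding makes this a
  comparison of values.\<close>

lemma polytime_eq:
  assumes "polytime e ea f" "polytime e ea g" "inj ea"
  shows "polytime e enc_bool (\<lambda>x. f x = g x)"
proof -
  have "computes (Assign 0 (EqualE (LeftE (Var 0)) (RightE (Var 0)))) 0 [:3, 4:] (enc_pair ea ea) enc_bool
      (\<lambda>y. fst y = snd y)"
    unfolding computes_def using assms(3)
    by (auto intro!: runs_Assign simp: mult_2_right enc_bool_def inj_eq)
  then have "polytime (enc_pair ea ea) enc_bool (\<lambda>y. fst y = snd y)" unfolding polytime_def by blast
  from polytime_comp[OF polytime_pair[OF assms(1,2)] this] show ?thesis by simp
qed

text \<open>The condition is computed beside a copy of the argument; the guard reads the left
  component, and each branch first discards it. The sum \<open>p + q\<close> covers whichever branch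
  runs.\<close>

lemma polytime_if:
  assumes "polytime e enc_bool b" "polytime e ea f" "polytime e ea g"
  shows "polytime e ea (\<lambda>x. if b x then f x else g x)"
proof -
  obtain c m p where c: "computes c m p e ea f" using assms(2) unfolding polytime_def by blast
  obtain d n q where d: "computes d n q e ea g" using assms(3) unfolding polytime_def by blast
  let ?A = "Assign 0 (RightE (Var 0))"
  have "computes (If (LeftE (Var 0)) (Seq ?A c) (Seq ?A d)) (max m n) ([:0, 2:] + ([:0, 2:] + (p + q)))
      (enc_pair enc_bool e) ea (\<lambda>y. if fst y then f (snd y) else g (snd y))"
    unfolding computes_def
  proof (intro allI impI, clarify)
    fix b x s assume s0: "s 0 = enc_pair enc_bool e (b, x)" and cl0: "clean (max m n) s"
    then have cl: "clean m s" "clean n s" by (auto elim: clean_mono)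
    let ?N = "tree_size (enc_pair enc_bool e (b, x))"
    let ?s = "s(0 := e x)"
    let ?t = "s(0 := ea (if b then f x else g x))"
    have le: "poly r (tree_size (e x)) \<le> poly r ?N" for r by (rule poly_nat_mono) simp
    have A: "runs ?A s (2 * ?N) ?s" by (rule runs_Assign) (simp_all add: s0)
    have C: "runs c ?s (poly p ?N) ?t" if b
      using computesD[OF c, of ?s x] that cl le[of p] by (auto simp: clean_upd intro: runs_mono)
    have D: "runs d ?s (poly q ?N) ?t" if "\<not> b"
      using computesD[OF d, of ?s x] that cl le[of q] by (auto simp: clean_upd intro: runs_mono)
    have "runs (If (LeftE (Var 0)) (Seq ?A c) (Seq ?A d)) s (2 * ?N + (2 * ?N + (poly p ?N + poly q ?N))) ?t"
    proof (rule runs_If)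
      show "runs (Seq ?A c) s (2 * ?N + (poly p ?N + poly q ?N)) ?t" if "val (LeftE (Var 0)) s \<noteq> Tip"
        using runs_Seq[OF A C] that s0 by (auto simp: enc_bool_def elim!: runs_mono split: if_splits)
      show "runs (Seq ?A d) s (2 * ?N + (poly p ?N + poly q ?N)) ?t" if "val (LeftE (Var 0)) s = Tip"
        using runs_Seq[OF A D] that s0 by (auto simp: enc_bool_def elim!: runs_mono split: if_splits)
    qed (simp add: s0)
    then show "runs (If (LeftE (Var 0)) (Seq ?A c) (Seq ?A d)) s
        (poly ([:0, 2:] + ([:0, 2:] + (p + q))) ?N)
        (s(0 := ea (if fst (b, x) then f (snd (b, x)) else g (snd (b, x)))))"
      by (rule runs_mono[THEN runs_cong]) (auto simp: algebra_simps)
  qed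
  then have "polytime (enc_pair enc_bool e) ea (\<lambda>y. if fst y then f (snd y) else g (snd y))"
    unfolding polytime_def by blast
  from polytime_comp[OF polytime_pair[OF assms(1) polytime_id] this] show ?thesis
    by (simp only: fst_conv snd_conv)
qed


subsection \<open>Iteration over a list\<close>

text \<open>Variable 0 is the accumulator, \<open>k\<close> keeps the parameter,
  \<open>Suc k\<close> the rest of the list, which is \<open>Tip\<close> exactly when it is empty
  and thus serves as guard. With \<open>S\<close> bounding all three, the triple handed to
  \<open>c\<close> has size at most \<open>2 + 3 * S\<close>. One round costs \<open>S\<close> for
  the guard, \<open>2 + 9 * S\<close> for building the triple, the run of \<open>c\<close>, and
  \<open>2 * S\<close> for dropping the head; the leading \<open>S\<close> pays for the last
  test.\<close>

lemma runs_fold_loop: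
  assumes c: "computes c m p (enc_pair e (enc_pair ea eb)) eb (\<lambda>(x, a, b). f x a b)"
    and k: "m \<le> k" "0 < k"
    and S: "\<And>n. n \<le> length zs \<Longrightarrow> tree_size (eb (fold (f x) (take n zs) b)) \<le> S"
    and L: "tree_size (enc_list ea zs) \<le> S" and X: "tree_size (e x) \<le> S"
    and s: "s 0 = eb b" "s k = e x" "s (Suc k) = enc_list ea zs" "clean m s"
  defines "body \<equiv> Seq (Assign 0 (NodeE (Var k) (NodeE (LeftE (Var (Suc k))) (Var 0))))
     (Seq c (Assign (Suc k) (RightE (Var (Suc k)))))"
  shows "runs (While (Var (Suc k)) body) s
    (S + length zs * (12 * S + 2 + poly p (2 + 3 * S))) (s(0 := eb (fold (f x) zs b), Suc k := Tip))"
  using S L s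
proof (induction zs arbitrary: b s)
  case Nil
  then show ?case using k by (intro runs_cong[OF runs_WhileFalse]) auto
next
  case (Cons a zs)
  note s = Cons.prems(3-6)
  have k': "k \<noteq> 0" "Suc k \<noteq> 0" "k \<noteq> Suc k" using k by auto
  have b: "tree_size (eb b) \<le> S" using Cons.prems(1)[of 0] by simp
  have za: "1 + tree_size (ea a) + tree_size (enc_list ea zs) \<le> S" using Cons.prems(2) by simp
  let ?s1 = "s(0 := enc_pair e (enc_pair ea eb) (x, a, b))"
  let ?s2 = "s(0 := eb (f x a b))"
  let ?s3 = "?s2(Suc k := enc_list ea zs)"
  have "tree_size (enc_pair e (enc_pair ea eb) (x, a, b)) \<le> 2 + 3 * S"
    using b za X by simp
  then have p: "poly p (tree_size (enc_pair e (enc_pair ea eb) (x, a, b))) \<le> poly p (2 + 3 * S)"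
    by (rule poly_nat_mono)
  have "runs c ?s1 (poly p (tree_size (enc_pair e (enc_pair ea eb) (x, a, b))))
      (?s1(0 := eb (case (x, a, b) of (x, a, b) \<Rightarrow> f x a b)))"
    by (rule computesD[OF c]) (use k k' s in \<open>auto intro!: clean_upd\<close>)
  then have c: "runs c ?s1 (poly p (2 + 3 * S)) ?s2"
    using runs_mono[OF _ p] by simp
  have "runs body s ((2 + 9 * S) + (poly p (2 + 3 * S) + 2 * S)) ?s3"
    unfolding body_def
  proof (rule runs_Seq[where s'="?s1"])
    show "runs (Assign 0 (NodeE (Var k) (NodeE (LeftE (Var (Suc k))) (Var 0)))) s (2 + 9 * S) ?s1"
      by (rule runs_Assign) (use b za X k' s in simp_all)
    show "runs (Seq c (Assign (Suc k) (RightE (Var (Suc k))))) ?s1 (poly p (2 + 3 * S) + 2 * S) ?s3"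
      by (rule runs_Seq[OF c], rule runs_Assign) (use za k' s in simp_all)
  qed
  moreover have "runs (While (Var (Suc k)) body) ?s3
      (S + length zs * (12 * S + 2 + poly p (2 + 3 * S)))
      (?s3(0 := eb (fold (f x) zs (f x a b)), Suc k := Tip))"
  proof (rule Cons.IH)
    show "tree_size (eb (fold (f x) (take n zs) (f x a b))) \<le> S" if "n \<le> length zs" for n
      using Cons.prems(1)[of "Suc n"] that by simp
    show "clean m ?s3" using s k by (auto intro!: clean_upd)
  qed (use za s k' in auto)
  ultimately have "runs (While (Var (Suc k)) body) s (S + ((2 + 9 * S) + (poly p (2 + 3 * S) + 2 * S)) +
      (S + length zs * (12 * S + 2 + poly p (2 + 3 * S))))
      (?s3(0 := eb (fold (f x) zs (f x a b)), Suc k := Tip))"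
    by (rule runs_WhileTrue[rotated 2]) (use Cons.prems(2) s in simp_all)
  then show ?case
    by (rule runs_mono[THEN runs_cong]) (auto simp: algebra_simps)
qed

lemma length_le_tree_size: "length xs \<le> tree_size (enc_list ea xs)"
  by (induction xs) auto

text \<open>Polynomial time for a single step is not enough: a step that doubles its accumulator
  would reach exponential size. Hence the hypothesis \<open>S\<close> on all intermediate
  results.\<close>

lemma polytime_fold:
  assumes l: "polytime e (enc_list ea) l" and z: "polytime e eb z"
    and f: "polytime (enc_pair e (enc_pair ea eb)) eb (\<lambda>y. f (fst y) (fst (snd y)) (snd (snd y)))"
    and S: "\<And>x n. n \<le> length (l x) \<Longrightarrow>
      tree_size (eb (fold (f x) (take n (l x)) (z x))) \<le> poly q (tree_size (e x))"
  shows "polytime e eb (\<lambda>x. fold (f x) (l x) (z x))"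
proof -
  have "(\<lambda>y. f (fst y) (fst (snd y)) (snd (snd y))) = (\<lambda>(x, a, b). f x a b)" by auto
  then obtain c m p where c: "computes c m p (enc_pair e (enc_pair ea eb)) eb (\<lambda>(x, a, b). f x a b)"
    using f unfolding polytime_def by metis
  let ?et = "enc_pair e (enc_pair eb (enc_list ea))"
  have "polytime e ?et (\<lambda>x. (x, z x, l x))"
    by (intro polytime_pair polytime_id z l)
  then obtain d n r where d: "computes d n r e ?et (\<lambda>x. (x, z x, l x))"
    unfolding polytime_def by blast
  obtain u where u: "\<And>x. tree_size (?et (x, z x, l x)) \<le> poly u (tree_size (e x))"
    using polytime_size[OF \<open>polytime e ?et (\<lambda>x. (x, z x, l x))\<close>] by blast
  define k where "k = Suc (max m n)"
  have k: "0 < k" "m \<le> k" "n \<le> k" by (auto simp: k_def)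
  define body where "body = Seq (Assign 0 (NodeE (Var k) (NodeE (LeftE (Var (Suc k))) (Var 0))))
     (Seq c (Assign (Suc k) (RightE (Var (Suc k)))))"
  define P where "P = Seq d (Seq (Assign k (LeftE (Var 0)))
    (Seq (Assign (Suc k) (RightE (RightE (Var 0)))) (Seq (Assign 0 (LeftE (RightE (Var 0))))
      (Seq (While (Var (Suc k)) body) (Assign k TipE)))))"
  define S where "S = q + u"
  \<comment> \<open>The parts are: \<open>r\<close> for setting up the triple, 1 for the final
    reset, 8 = 2 + 3 + 3 for the three assignments unpacking it, and the loop, whose number of
    rounds is at most \<open>u\<close>.\<close>
  define w where "w = r + [:1:] + smult 8 u + (S + u * (smult 12 S + [:2:] + pcompose p ([:2:] + smult 3 S)))"
  have "computes P (Suc (Suc k)) w e eb (\<lambda>x. fold (f x) (l x) (z x))"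
    unfolding computes_def
  proof (intro allI impI)
    fix x s assume s0: "s 0 = e x" and cl0: "clean (Suc (Suc k)) s"
    have cl: "clean m s" "clean n s" and sk: "s k = Tip" "s (Suc k) = Tip"
      using cl0 k by (auto elim: clean_mono) (auto simp: clean_def)
    let ?N = "tree_size (e x)"
    let ?T = "poly S ?N"
    have sz: "tree_size (e x) + tree_size (eb (z x)) + tree_size (enc_list ea (l x)) + 2 \<le> poly u ?N"
      using u[of x] by simp
    let ?s1 = "s(0 := ?et (x, z x, l x))"
    let ?s2 = "?s1(k := e x)"
    let ?s3 = "?s2(Suc k := enc_list ea (l x))"
    let ?s4 = "?s3(0 := eb (z x))"
    let ?s5 = "?s4(0 := eb (fold (f x) (l x) (z x)), Suc k := Tip)"
    have d': "runs d s (poly r ?N) ?s1"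
      by (rule computesD[OF d]) (use s0 cl in simp_all)
    have loop: "runs (While (Var (Suc k)) body) ?s4
        (?T + length (l x) * (12 * ?T + 2 + poly p (2 + 3 * ?T))) ?s5"
      unfolding body_def
    proof (rule runs_fold_loop[OF c k(2,1)])
      show "tree_size (eb (fold (f x) (take n (l x)) (z x))) \<le> ?T" if "n \<le> length (l x)" for n
        using S[OF that] by (simp add: S_def)
      show "clean m ?s4" using k cl by (auto intro!: clean_upd)
    qed (use sz k in \<open>simp_all add: S_def\<close>)
    have "runs P s (poly r ?N + (2 * poly u ?N + (3 * poly u ?N + (3 * poly u ?N +
        ((?T + length (l x) * (12 * ?T + 2 + poly p (2 + 3 * ?T))) + 1))))) (?s5(k := Tip))"
      unfolding P_def
      apply (rule runs_Seq[OF d'])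
      apply (rule runs_Seq[where s'="?s2"], rule runs_Assign, use sz in simp, simp)
      apply (rule runs_Seq[where s'="?s3"], rule runs_Assign, use sz k in simp, use k in simp)
      apply (rule runs_Seq[where s'="?s4"], rule runs_Assign, use sz k in simp, use k in simp)
      apply (rule runs_Seq[OF loop], rule runs_Assign; simp)
      done
    moreover have "?s5(k := Tip) = s(0 := eb (fold (f x) (l x) (z x)))"
      using k sk by auto
    moreover have "length (l x) * (12 * ?T + 2 + poly p (2 + 3 * ?T)) \<le>
        poly u ?N * (12 * ?T + 2 + poly p (2 + 3 * ?T))"
      using sz length_le_tree_size[of "l x" ea] by (intro mult_right_mono) auto
    ultimately show "runs P s (poly w ?N) (s(0 := eb (fold (f x) (l x) (z x))))"
      by (auto elim!: runs_mono simp: w_def poly_pcompose algebra_simps)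
  qed
  then show ?thesis unfolding polytime_def by blast
qed


section \<open>List operations as folds of controlled growth\<close>

lemma tree_size_mem:
  "a \<in> set xs \<Longrightarrow> tree_size (ea a) \<le> tree_size (enc_list ea xs)"
  by (induction xs) auto

lemma tree_size_fold:
  assumes "\<And>a b. a \<in> set xs \<Longrightarrow> tree_size (eb (g a b)) \<le> tree_size (eb b) + B"
  shows "tree_size (eb (fold g xs b)) \<le> tree_size (eb b) + length xs * B"
  using assms
proof (induction xs arbitrary: b)
  case (Cons a xs)
  have "tree_size (eb (fold g xs (g a b))) \<le> tree_size (eb (g a b)) + length xs * B"
    by (rule Cons.IH) (use Cons.prems in auto)
  moreover have "tree_size (eb (g a b)) \<le> tree_size (eb b) + B"
    using Cons.prems by simp
  ultimately show ?case by simp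
qed simp

text \<open>If the growth in each step depends only on the parameter and the current element, it
  adds up to at most the length of the list times one polynomial bound. This discharges the size
  condition of \<open>polytime_fold\<close>.\<close>

lemma polytime_fold_additive:
  assumes l: "polytime e (enc_list ea) l" and z: "polytime e eb z"
    and f: "polytime (enc_pair e (enc_pair ea eb)) eb (\<lambda>y. f (fst y) (fst (snd y)) (snd (snd y)))"
    and q: "\<And>x a b. tree_size (eb (f x a b)) \<le> tree_size (eb b) + poly q (tree_size (enc_pair e ea (x, a)))"
  shows "polytime e eb (\<lambda>x. fold (f x) (l x) (z x))"
proof -
  obtain u where u: "\<And>x. tree_size (enc_list ea (l x)) \<le> poly u (tree_size (e x))"
    using polytime_size[OF l] by blast
  obtain v where v: "\<And>x. tree_size (eb (z x)) \<le> poly v (tree_size (e x))"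
    using polytime_size[OF z] by blast
  define w where "w = v + u * pcompose q ([:1, 1:] + u)"
  show ?thesis
  proof (rule polytime_fold[OF l z f, where q=w])
    fix x n assume n: "n \<le> length (l x)"
    let ?B = "poly q (1 + tree_size (e x) + poly u (tree_size (e x)))"
    have "tree_size (eb (fold (f x) (take n (l x)) (z x))) \<le>
        tree_size (eb (z x)) + length (take n (l x)) * ?B"
    proof (rule tree_size_fold)
      fix a b assume "a \<in> set (take n (l x))"
      then have "a \<in> set (l x)" by (rule in_set_takeD)
      then have "tree_size (enc_pair e ea (x, a)) \<le> 1 + tree_size (e x) + poly u (tree_size (e x))"
        using tree_size_mem[of a "l x" ea] u[of x] by simp
      then show "tree_size (eb (f x a b)) \<le> tree_size (eb b) + ?B"
        using q[of x a b] poly_nat_mono order_trans add_left_mono by meson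
    qed
    also have "\<dots> \<le> poly v (tree_size (e x)) + poly u (tree_size (e x)) * ?B"
      using v n u[of x] length_le_tree_size[of "l x" ea] by (intro add_mono mult_right_mono) auto
    finally show "tree_size (eb (fold (f x) (take n (l x)) (z x))) \<le> poly w (tree_size (e x))"
      by (simp add: w_def poly_pcompose algebra_simps)
  qed
qed

lemma polytime_Cons:
  assumes "polytime e ea f" "polytime e (enc_list ea) g"
  shows "polytime e (enc_list ea) (\<lambda>x. f x # g x)"
  by (rule polytime_cong[OF polytime_pair[OF assms]]) simp

lemma polytime_rev:
  assumes l: "polytime e (enc_list ea) l"
  shows "polytime e (enc_list ea) (\<lambda>x. rev (l x))"
proof -
  have "polytime e (enc_list ea) (\<lambda>x. fold (\<lambda>a b. a # b) (l x) [])"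
    by (rule polytime_fold_additive[OF l polytime_const, where q="[:0, 1:]"])
      ((rule polytime_Cons polytime_fst polytime_snd polytime_id)+, simp)
  then show ?thesis by (simp add: fold_Cons_rev)
qed

lemma polytime_foldr:
  assumes l: "polytime e (enc_list ea) l" and z: "polytime e eb z"
    and f: "polytime (enc_pair e (enc_pair ea eb)) eb (\<lambda>y. f (fst y) (fst (snd y)) (snd (snd y)))"
    and q: "\<And>x a b. tree_size (eb (f x a b)) \<le> tree_size (eb b) + poly q (tree_size (enc_pair e ea (x, a)))"
  shows "polytime e eb (\<lambda>x. foldr (f x) (l x) (z x))"
  unfolding foldr_conv_fold
  by (rule polytime_fold_additive[OF polytime_rev[OF l] z f q])

lemma polytime_map:
  assumes l: "polytime e (enc_list ea) l" and f: "polytime (enc_pair e ea) eb (\<lambda>y. f (fst y) (snd y))"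
  shows "polytime e (enc_list eb) (\<lambda>x. map (f x) (l x))"
proof -
  obtain p where p: "\<And>y. tree_size (eb (f (fst y) (snd y))) \<le> poly p (tree_size (enc_pair e ea y))"
    using polytime_size[OF f] by blast
  have f': "polytime (enc_pair e (enc_pair ea (enc_list eb))) eb (\<lambda>y. f (fst y) (fst (snd y)))"
    by (rule polytime_comp[OF _ f, where f="\<lambda>y. (fst y, fst (snd y))", simplified])
      ((rule polytime_pair polytime_fst polytime_snd polytime_id)+)
  have "polytime e (enc_list eb) (\<lambda>x. foldr (\<lambda>a b. f x a # b) (l x) [])"
    by (rule polytime_foldr[OF l polytime_const, where q="[:1:] + p"],
        (rule polytime_Cons f' polytime_snd polytime_id)+, use p[of "(_, _)"] in simp)
  moreover have "foldr (\<lambda>a b. g a # b) xs [] = map g xs" for g :: "'b \<Rightarrow> 'c" and xs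
    by (induction xs) auto
  ultimately show ?thesis by simp
qed

lemma polytime_filter:
  assumes l: "polytime e (enc_list ea) l" and P: "polytime (enc_pair e ea) enc_bool (\<lambda>y. P (fst y) (snd y))"
  shows "polytime e (enc_list ea) (\<lambda>x. filter (P x) (l x))"
proof -
  have P': "polytime (enc_pair e (enc_pair ea (enc_list ea))) enc_bool (\<lambda>y. P (fst y) (fst (snd y)))"
    by (rule polytime_comp[OF _ P, where f="\<lambda>y. (fst y, fst (snd y))", simplified])
      ((rule polytime_pair polytime_fst polytime_snd polytime_id)+)
  have "polytime e (enc_list ea) (\<lambda>x. foldr (\<lambda>a b. if P x a then a # b else b) (l x) [])"
    by (rule polytime_foldr[OF l polytime_const, where q="[:0, 1:]"])
      ((rule polytime_if P' polytime_Cons polytime_fst polytime_snd polytime_id)+, simp)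
  moreover have "foldr (\<lambda>a b. if Q a then a # b else b) xs [] = filter Q xs" for Q :: "'b \<Rightarrow> bool" and xs
    by (induction xs) auto
  ultimately show ?thesis by simp
qed

lemma polytime_append:
  assumes "polytime e (enc_list ea) f" "polytime e (enc_list ea) g"
  shows "polytime e (enc_list ea) (\<lambda>x. f x @ g x)"
proof -
  have "polytime e (enc_list ea) (\<lambda>x. foldr (\<lambda>a b. a # b) (f x) (g x))"
    by (rule polytime_foldr[OF assms, where q="[:0, 1:]"])
      ((rule polytime_Cons polytime_fst polytime_snd polytime_id)+, simp)
  moreover have "foldr (\<lambda>a b. a # b) xs ys = xs @ ys" for xs ys :: "'b list"
    by (induction xs) auto
  ultimately show ?thesis by simp
qed

lemma tree_size_append: "tree_size (enc_list ea (xs @ ys)) \<le> tree_size (enc_list ea ys) + tree_size (enc_list ea xs)"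
  by (induction xs) auto

lemma polytime_concat:
  assumes "polytime e (enc_list (enc_list ea)) f"
  shows "polytime e (enc_list ea) (\<lambda>x. concat (f x))"
proof -
  have "polytime e (enc_list ea) (\<lambda>x. foldr (\<lambda>a b. a @ b) (f x) [])"
    by (rule polytime_foldr[OF assms polytime_const, where q="[:0, 1:]"],
        (rule polytime_append polytime_fst polytime_snd polytime_id)+,
        rule order_trans[OF tree_size_append], simp)
  then show ?thesis by (simp add: concat_conv_foldr)
qed


subsection \<open>Numbers\<close>

text \<open>The digits as a list, which makes the loops over lists available for arithmetic.\<close>

fun bits :: "nat \<Rightarrow> bool list" where
  "bits n = (if n = 0 then [] else odd n # bits (n div 2))"

declare bits.simps [simp del]

lemma enc_nat_bits: "enc_nat n = enc_list enc_bool (bits n)"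
proof (induction n rule: less_induct)
  case (less n)
  then show ?case by (simp add: enc_nat.simps[of n] bits.simps[of n])
qed

text \<open>One step of binary increment: a carry flag and the digits produced so far, in reverse. A
  carry flips the digit and survives exactly if the digit was 1. Negation is spelled as a
  conditional to fit the closure rules proved so far.\<close>

definition carry_step :: "bool \<Rightarrow> bool \<times> bool list \<Rightarrow> bool \<times> bool list" where
  "carry_step d r = (if fst r then (d, (if d then False else True) # snd r) else (fst r, d # snd r))"

definition carry_out :: "bool \<times> bool list \<Rightarrow> bool list" where
  "carry_out r = rev (if fst r then True # snd r else snd r)"

lemma carry_out_False: "carry_out (fold carry_step bs (False, b)) = rev b @ bs"
  by (induction bs arbitrary: b) (auto simp: carry_step_def carry_out_def)

text \<open>An odd number passes the carry on to \<open>n div 2\<close>, where the induction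
  hypothesis applies; an even one absorbs it, and the remaining digits are copied by
  \<open>carry_out_False\<close>.\<close>

lemma carry_out_True: "carry_out (fold carry_step (bits n) (True, b)) = rev b @ bits (Suc n)"
proof (induction n arbitrary: b rule: less_induct)
  case (less n)
  show ?case
  proof (cases "n = 0")
    case True
    then show ?thesis by (simp add: carry_out_def bits.simps[of "Suc 0"] bits.simps[of 0])
  next
    case False
    have Suc_n: "bits (Suc n) = even n # bits (if odd n then Suc (n div 2) else n div 2)"
      by (subst bits.simps) auto
    have "fold carry_step (bits n) (True, b) = fold carry_step (bits (n div 2)) (odd n, even n # b)"
      using False by (simp add: bits.simps[of n] carry_step_def)
    then show ?thesis
      using less.IH[of "n div 2"] False by (cases "odd n") (simp_all add: carry_out_False Suc_n)
  qed
qed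

lemma polytime_Suc:
  assumes "polytime e enc_nat f" shows "polytime e enc_nat (\<lambda>x. Suc (f x))"
proof -
  let ?eb = "enc_list enc_bool"
  have "polytime ?eb (enc_pair enc_bool ?eb) (\<lambda>bs. fold carry_step bs (True, []))"
    unfolding carry_step_def
    \<comment> \<open>4 is one list node plus one digit of size at most 3.\<close>
    by (rule polytime_fold_additive[OF polytime_id polytime_const, where q="[:4:]"],
        (rule polytime_if polytime_Cons polytime_pair polytime_fst polytime_snd polytime_id polytime_const)+)
      (auto simp: enc_bool_def)
  then have "polytime ?eb ?eb (\<lambda>bs. carry_out (fold carry_step bs (True, [])))"
    by (rule polytime_comp) (unfold carry_out_def,
      (rule polytime_rev polytime_if polytime_Cons polytime_fst polytime_snd polytime_id polytime_const)+)
  then have "polytime enc_nat ?eb (\<lambda>n. carry_out (fold carry_step (bits n) (True, [])))"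
    by (rule polytime_dom_cong) (simp add: enc_nat_bits)
  then have "polytime enc_nat enc_nat Suc"
    by (rule polytime_cong) (simp add: carry_out_True enc_nat_bits)
  from polytime_comp[OF assms this] show ?thesis .
qed

text \<open>Far from the true logarithmic size, but sufficient for numbers bounded by the length of
  a list.\<close>

lemma tree_size_enc_nat: "tree_size (enc_nat n) \<le> 4 * n + 1"
proof (induction n rule: less_induct)
  case (less n)
  show ?case
  proof (cases "n = 0")
    case False
    have "tree_size (enc_bool (odd n)) \<le> 3" "Suc (n div 2) \<le> n"
      using False by (simp_all add: enc_bool_def Suc_le_eq)
    then show ?thesis using less[of "n div 2"] False by (simp add: enc_nat.simps[of n])
  qed (simp add: enc_nat.simps[of 0])
qed

lemma tree_size_enc_nat_Suc: "tree_size (enc_nat (Suc n)) \<le> tree_size (enc_nat n) + 4"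
proof (induction n rule: less_induct)
  case (less n)
  show ?case
  proof (cases "n = 0")
    case True
    then show ?thesis by (simp add: enc_nat.simps[of 0] enc_nat.simps[of "Suc 0"] enc_bool_def)
  next
    case False
    then show ?thesis using less[of "n div 2"]
      by (cases "odd n") (simp_all add: enc_nat.simps[of n] enc_nat.simps[of "Suc n"] enc_bool_def)
  qed
qed

lemma polytime_length:
  assumes "polytime e (enc_list ea) f" shows "polytime e enc_nat (\<lambda>x. length (f x))"
proof -
  have "polytime e enc_nat (\<lambda>x. foldr (\<lambda>a b. Suc b) (f x) 0)"
    by (rule polytime_foldr[OF assms polytime_const, where q="[:4:]"])
      ((rule polytime_Suc polytime_snd polytime_id)+, simp add: tree_size_enc_nat_Suc)
  moreover have "foldr (\<lambda>a b. Suc b) xs 0 = length xs" for xs :: "'b list"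
    by (induction xs) auto
  ultimately show ?thesis by simp
qed

text \<open>Total: for a missing \<open>k\<close> the result is the length of the list, so its size
  stays bounded on every input.\<close>

definition position :: "'a \<Rightarrow> 'a list \<Rightarrow> nat" where
  "position k xs = foldr (\<lambda>a r. if a = k then 0 else Suc r) xs 0"

lemma position_less: "k \<in> set xs \<Longrightarrow> position k xs < length xs"
  by (induction xs) (auto simp: position_def)

lemma nth_position: "k \<in> set xs \<Longrightarrow> xs ! position k xs = k"
  by (induction xs) (auto simp: position_def)

lemma polytime_position:
  assumes f: "polytime e (enc_list ea) f" and k: "polytime e ea k" and inj: "inj ea"
  shows "polytime e enc_nat (\<lambda>x. position (k x) (f x))"
proof -
  have k': "polytime (enc_pair e (enc_pair ea enc_nat)) ea (\<lambda>y. k (fst y))"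
    by ((rule polytime_comp[OF _ k] polytime_fst polytime_id)+)
  show ?thesis unfolding position_def
    by (rule polytime_foldr[OF f polytime_const, where q="[:4:]"],
        (rule polytime_if polytime_eq polytime_Suc k' inj polytime_fst polytime_snd polytime_id polytime_const)+)
      (auto simp: enc_nat.simps[of 0] intro: order_trans[OF tree_size_enc_nat_Suc])
qed

lemma fold_enumerate:
  "fold (\<lambda>a kb. (Suc (fst kb), (fst kb, a) # snd kb)) xs (k, b) = (k + length xs, rev (List.enumerate k xs) @ b)"
  by (induction xs arbitrary: k b) auto

lemma tree_size_enumerate:
  "tree_size (enc_list (enc_pair enc_nat ea) (List.enumerate k xs)) \<le>
    tree_size (enc_list ea xs) + length xs * (4 * (k + length xs) + 2)"
proof (induction xs arbitrary: k)
  case (Cons a xs)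
  have "tree_size (enc_nat k) \<le> 4 * (k + Suc (length xs)) + 1"
    using tree_size_enc_nat[of k] by simp
  then show ?case using Cons[of "Suc k"] by simp
qed simp

lemma tree_size_rev: "tree_size (enc_list ea (rev xs)) = tree_size (enc_list ea xs)"
proof -
  have "tree_size (enc_list ea (xs @ ys)) + 1 = tree_size (enc_list ea xs) + tree_size (enc_list ea ys)" for xs ys
    by (induction xs) auto
  note app = this[of "rev _" "[_]"]
  show ?thesis
  proof (induction xs)
    case (Cons a xs)
    then show ?case using app[of xs a] by simp
  qed simp
qed

lemma tree_size_take: "tree_size (enc_list ea (take n xs)) \<le> tree_size (enc_list ea xs)"
proof (induction xs arbitrary: n)
  case (Cons a xs)
  then show ?case by (cases n) auto
qed simp

text \<open>Each step copies the counter out of the accumulator, so the growth depends on the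
  accumulator and the additive rule does not apply. The size is bounded by evaluating the partial
  folds explicitly: at most n indices, each of size linear in n.\<close>

lemma polytime_enumerate:
  assumes f: "polytime e (enc_list ea) f"
  shows "polytime e (enc_list (enc_pair enc_nat ea)) (\<lambda>x. List.enumerate 0 (f x))"
proof -
  obtain u where u: "\<And>x. tree_size (enc_list ea (f x)) \<le> poly u (tree_size (e x))"
    using polytime_size[OF f] by blast
  define w where "w = [:2:] + smult 4 u + (u + u * (smult 4 u + [:2:]))"
  have "polytime e (enc_pair enc_nat (enc_list (enc_pair enc_nat ea)))
      (\<lambda>x. fold (\<lambda>a kb. (Suc (fst kb), (fst kb, a) # snd kb)) (f x) (0, []))"
  proof (rule polytime_fold[OF f polytime_const, where q=w])
    fix x n assume n: "n \<le> length (f x)"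
    let ?N = "poly u (tree_size (e x))"
    have "length (f x) \<le> ?N" using u[of x] length_le_tree_size[of "f x" ea] by simp
    with n have n': "n \<le> ?N" by simp
    have "tree_size (enc_list (enc_pair enc_nat ea) (List.enumerate 0 (take n (f x)))) \<le>
        tree_size (enc_list ea (take n (f x))) + n * (4 * n + 2)"
      using tree_size_enumerate[of ea 0 "take n (f x)"] n by simp
    also have "\<dots> \<le> ?N + ?N * (4 * ?N + 2)"
      using n' u[of x] tree_size_take[of ea n "f x"]
      by (intro add_mono mult_mono) (auto intro: order_trans)
    finally have "tree_size (enc_list (enc_pair enc_nat ea) (List.enumerate 0 (take n (f x)))) \<le> \<dots>" .
    then show "tree_size (enc_pair enc_nat (enc_list (enc_pair enc_nat ea))
        (fold (\<lambda>a kb. (Suc (fst kb), (fst kb, a) # snd kb)) (take n (f x)) (0, [])))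
        \<le> poly w (tree_size (e x))"
      using tree_size_enc_nat[of n] n n'
      by (simp add: fold_enumerate tree_size_rev w_def algebra_simps)
  qed ((rule polytime_pair polytime_Cons polytime_Suc polytime_fst polytime_snd polytime_id)+)
  from polytime_rev[OF polytime_snd[OF this]] show ?thesis
    by (simp add: fold_enumerate)
qed

text \<open>The count stays 0 up to index \<open>k\<close>, becomes positive there and then
  increases with every index.\<close>

lemma fold_monus: "fold (\<lambda>i c. if i = k \<or> c \<noteq> 0 then Suc c else c) [0..<n] 0 = n - k"
  by (induction n) auto

text \<open>Since \<open>k\<close> may be exponentially larger than its encoding, it cannot be
  counted down. Instead the loop runs through the indices of the list and only compares them with
  \<open>k\<close>; truncation at 0 comes for free.\<close>

lemma polytime_length_minus:
  assumes f: "polytime e (enc_list ea) f" and k: "polytime e enc_nat k"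
  shows "polytime e enc_nat (\<lambda>x. length (f x) - k x)"
proof -
  have k': "polytime (enc_pair e (enc_pair enc_nat enc_nat)) enc_nat (\<lambda>y. k (fst y))"
    by ((rule polytime_comp[OF _ k] polytime_fst polytime_id)+)
  have l: "polytime e (enc_list enc_nat) (\<lambda>x. map fst (List.enumerate 0 (f x)))"
    by ((rule polytime_map polytime_enumerate f polytime_fst polytime_snd polytime_id)+)
  have "polytime e enc_nat (\<lambda>x. fold (\<lambda>i c. if i = k x then Suc c else if c = 0 then c else Suc c)
      (map fst (List.enumerate 0 (f x))) 0)"
    by (rule polytime_fold_additive[OF l polytime_const, where q="[:4:]"],
        (rule polytime_if polytime_eq polytime_Suc k' polytime_fst polytime_snd polytime_id polytime_const
          inj_enc_nat)+)
      (auto simp: tree_size_enc_nat_Suc)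
  moreover have "(\<lambda>i c. if i = k x then Suc c else if c = 0 then c else Suc c) =
      (\<lambda>i c. if i = k x \<or> c \<noteq> 0 then Suc c else c)" for x by (auto simp: fun_eq_iff)
  ultimately show ?thesis by (simp add: fold_monus[simplified])
qed


section \<open>From routings to subgroup distance\<close>

lemma polytime_not:
  assumes "polytime e enc_bool b" shows "polytime e enc_bool (\<lambda>x. \<not> b x)"
proof -
  have "polytime e enc_bool (\<lambda>x. if b x then False else True)"
    by (rule polytime_if assms polytime_const)+
  then show ?thesis by (rule polytime_cong) auto
qed

lemma polytime_int:
  assumes "polytime e enc_nat f" shows "polytime e enc_int (\<lambda>x. int (f x))"
proof -
  have "polytime e (enc_pair enc_bool enc_nat) (\<lambda>x. (False, f x))"
    by (rule polytime_pair polytime_const assms)+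
  then show ?thesis by (rule polytime_cong) (simp add: enc_int_def)
qed

lemma polytime_ri:
  shows polytime_ri_classes: "polytime e enc_routing_instance f \<Longrightarrow>
      polytime e (enc_list (enc_list enc_nat)) (\<lambda>x. ri_classes (f x))"
    and polytime_ri_arcs: "polytime e enc_routing_instance f \<Longrightarrow>
      polytime e (enc_list (enc_pair enc_nat (enc_pair enc_nat (enc_pair enc_nat enc_nat)))) (\<lambda>x. ri_arcs (f x))"
    and polytime_ri_bound: "polytime e enc_routing_instance f \<Longrightarrow> polytime e enc_nat (\<lambda>x. ri_bound (f x))"
proof -
  let ?et = "enc_pair (enc_list (enc_list enc_nat))
    (enc_pair (enc_list (enc_pair enc_nat (enc_pair enc_nat (enc_pair enc_nat enc_nat)))) enc_nat)"
  assume f: "polytime e enc_routing_instance f"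
  have t: "polytime e ?et (\<lambda>x. (ri_classes (f x), ri_arcs (f x), ri_bound (f x)))"
    by (rule polytime_cong[OF f]) (simp add: enc_routing_instance_def)
  show "polytime e (enc_list (enc_list enc_nat)) (\<lambda>x. ri_classes (f x))"
    using polytime_fst[OF t] by simp
  show "polytime e (enc_list (enc_pair enc_nat (enc_pair enc_nat (enc_pair enc_nat enc_nat)))) (\<lambda>x. ri_arcs (f x))"
    using polytime_fst[OF polytime_snd[OF t]] by simp
  show "polytime e enc_nat (\<lambda>x. ri_bound (f x))"
    using polytime_snd[OF polytime_snd[OF t]] by simp
qed

text \<open>In a switching circuit, start vertex and out-label determine an edge. Looking up the
  head and in-label of an edge here thus finds its successor under straight routing.\<close>

definition out_keys :: "routing_instance \<Rightarrow> (nat \<times> nat) list" where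
  "out_keys I = map (\<lambda>a. (fst a, fst (snd a))) (ri_arcs I)"

text \<open>Edges are counted from 0, points from 1.\<close>

definition edge_point :: "routing_instance \<Rightarrow> nat \<times> nat \<Rightarrow> nat" where
  "edge_point I k = Suc (position k (out_keys I))"

text \<open>Vertices of valency 2 are recognised by an outgoing edge labelled 2. A class without
  them offers no choice and yields \<open>[]\<close>, which \<open>to_distance\<close> removes
  because generators must be nonempty.\<close>

definition class_involution :: "routing_instance \<Rightarrow> nat list \<Rightarrow> (nat \<times> nat) list" where
  "class_involution I C = map (\<lambda>v. (edge_point I (v, 1), edge_point I (v, 2)))
     (filter (\<lambda>v. filter (\<lambda>k. k = (v, 2)) (out_keys I) \<noteq> []) C)"

text \<open>No distance is negative, so the bound \<open>-1\<close> stands for every negative bound.\<close>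

definition to_distance :: "routing_instance \<Rightarrow> distance_instance" where
  "to_distance I =
     \<lparr> di_degree = length (ri_arcs I),
       di_images = map (\<lambda>a. edge_point I (snd (snd a))) (ri_arcs I),
       di_gens = filter (\<lambda>\<gamma>. \<gamma> \<noteq> []) (map (class_involution I) (ri_classes I)),
       di_bound = (if ri_bound I \<le> length (ri_arcs I) then int (length (ri_arcs I) - ri_bound I) else - 1) \<rparr>"

lemma polytime_edge_point:
  assumes "polytime e enc_routing_instance f" "polytime e (enc_pair enc_nat enc_nat) g"
  shows "polytime e enc_nat (\<lambda>x. edge_point (f x) (g x))"
  unfolding edge_point_def out_keys_def
  by (rule polytime_Suc polytime_position polytime_map polytime_pair polytime_ri_arcs assms
      inj_enc_pair inj_enc_nat polytime_fst polytime_snd polytime_id)+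

lemma polytime_class_involution:
  assumes "polytime e enc_routing_instance f" "polytime e (enc_list enc_nat) g"
  shows "polytime e (enc_list (enc_pair enc_nat enc_nat)) (\<lambda>x. class_involution (f x) (g x))"
proof -
  have "polytime (enc_pair enc_routing_instance (enc_list enc_nat)) (enc_list (enc_pair enc_nat enc_nat))
      (\<lambda>y. class_involution (fst y) (snd y))"
    unfolding class_involution_def out_keys_def
    by (rule polytime_not polytime_filter polytime_map polytime_edge_point polytime_pair polytime_ri_arcs
        polytime_fst polytime_snd polytime_id polytime_eq[where ea="enc_pair enc_nat enc_nat"]
        polytime_eq[where ea="enc_list (enc_pair enc_nat enc_nat)"]
        inj_enc_list inj_enc_pair inj_enc_nat polytime_const)+
  from polytime_comp[OF polytime_pair[OF assms] this] show ?thesis by simp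
qed

lemma polytime_to_distance: "polytime enc_routing_instance enc_distance_instance to_distance"
proof -
  let ?I = enc_routing_instance
  have deg: "polytime ?I enc_nat (\<lambda>I. length (ri_arcs I))"
    by (rule polytime_length polytime_ri_arcs polytime_id)+
  have images: "polytime ?I (enc_list enc_nat) (\<lambda>I. map (\<lambda>a. edge_point I (snd (snd a))) (ri_arcs I))"
    by (rule polytime_map polytime_edge_point polytime_ri_arcs polytime_fst polytime_snd polytime_id)+
  have gens: "polytime ?I (enc_list (enc_list (enc_pair enc_nat enc_nat)))
      (\<lambda>I. filter (\<lambda>\<gamma>. \<gamma> \<noteq> []) (map (class_involution I) (ri_classes I)))"
    by (rule polytime_filter polytime_map polytime_class_involution polytime_not
        polytime_eq[where ea="enc_list (enc_pair enc_nat enc_nat)"] polytime_ri_classes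
        polytime_fst polytime_snd polytime_id polytime_const inj_enc_list inj_enc_pair inj_enc_nat)+
  \<comment> \<open>The comparison with the bound is made by truncated subtraction: prefixing one
    dummy element, \<open>Suc N - K = 0\<close> says exactly that \<open>K\<close> exceeds the
    number \<open>N\<close> of edges.\<close>
  have "polytime ?I enc_int (\<lambda>I. if length (() # map (\<lambda>_. ()) (ri_arcs I)) - ri_bound I = 0 then - 1
      else int (length (ri_arcs I) - ri_bound I))"
    by (rule polytime_if polytime_eq[where ea=enc_nat] inj_enc_nat polytime_int polytime_const
        polytime_length_minus polytime_Cons[where ea="\<lambda>_. Tip"] polytime_map polytime_ri_arcs
        polytime_ri_bound polytime_id)+
  then have bound: "polytime ?I enc_int (\<lambda>I. if ri_bound I \<le> length (ri_arcs I)
      then int (length (ri_arcs I) - ri_bound I) else - 1)"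
    by (rule polytime_cong) (auto simp: not_le)
  have "polytime ?I (enc_pair enc_nat (enc_pair (enc_list enc_nat)
      (enc_pair (enc_list (enc_list (enc_pair enc_nat enc_nat))) enc_int)))
      (\<lambda>I. (length (ri_arcs I), map (\<lambda>a. edge_point I (snd (snd a))) (ri_arcs I),
        filter (\<lambda>\<gamma>. \<gamma> \<noteq> []) (map (class_involution I) (ri_classes I)),
        if ri_bound I \<le> length (ri_arcs I) then int (length (ri_arcs I) - ri_bound I) else - 1))"
    by (rule polytime_pair deg images gens bound)+
  then show ?thesis
    by (rule polytime_cong) (simp add: enc_distance_instance_def to_distance_def)
qed


section \<open>From subgroup distance to routings\<close>

lemma polytime_di:
  assumes f: "polytime e enc_distance_instance f"
  shows polytime_di_images: "polytime e (enc_list enc_nat) (\<lambda>x. di_images (f x))"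
    and polytime_di_gens: "polytime e (enc_list (enc_list (enc_pair enc_nat enc_nat))) (\<lambda>x. di_gens (f x))"
    and polytime_di_bound: "polytime e enc_int (\<lambda>x. di_bound (f x))"
proof -
  let ?et = "enc_pair enc_nat (enc_pair (enc_list enc_nat)
      (enc_pair (enc_list (enc_list (enc_pair enc_nat enc_nat))) enc_int))"
  have t: "polytime e ?et (\<lambda>x. (di_degree (f x), di_images (f x), di_gens (f x), di_bound (f x)))"
    by (rule polytime_cong[OF f]) (simp add: enc_distance_instance_def)
  show "polytime e (enc_list enc_nat) (\<lambda>x. di_images (f x))"
    using polytime_fst[OF polytime_snd[OF t]] by simp
  show "polytime e (enc_list (enc_list (enc_pair enc_nat enc_nat))) (\<lambda>x. di_gens (f x))"
    using polytime_fst[OF polytime_snd[OF polytime_snd[OF t]]] by simp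
  show "polytime e enc_int (\<lambda>x. di_bound (f x))"
    using polytime_snd[OF polytime_snd[OF polytime_snd[OF t]]] by simp
qed

lemma polytime_negative:
  assumes "polytime e enc_int f" shows "polytime e enc_bool (\<lambda>x. f x < 0)"
  by (rule polytime_comp[OF assms], rule polytime_LeftE) (simp add: enc_int_def)

lemma polytime_nat_abs:
  assumes "polytime e enc_int f" shows "polytime e enc_nat (\<lambda>x. nat \<bar>f x\<bar>)"
  by (rule polytime_comp[OF assms], rule polytime_RightE) (simp add: enc_int_def)

text \<open>The start vertex and the out-label of the edge that becomes the point \<open>e\<close>: a pair
  \<open>(x, y)\<close> of a generator becomes a vertex named \<open>x\<close> with outgoing edges \<open>x\<close> and \<open>y\<close>, every
  other point \<open>z\<close> a vertex named \<open>z\<close> with outgoing edge \<open>z\<close>.\<close>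

definition source :: "(nat \<times> nat) list \<Rightarrow> nat \<Rightarrow> nat \<times> nat" where
  "source ps e = foldr (\<lambda>p r. if snd p = e then (fst p, 2) else r) ps (e, 1)"

definition unmoved :: "(nat \<times> nat) list \<Rightarrow> nat \<Rightarrow> bool" where
  "unmoved ps z \<longleftrightarrow> filter (\<lambda>p. if fst p = z then True else snd p = z) ps = []"

text \<open>Edge 0 is an additional loop, fixed by every permutation. It guarantees a cycle, so that
  the positive bound 1 is met by all routings even if the degree is 0.\<close>

definition to_routing :: "distance_instance \<Rightarrow> routing_instance" where
  "to_routing J = (let ps = concat (di_gens J); es = List.enumerate 0 (0 # di_images J) in
     \<lparr> ri_classes = map (map fst) (di_gens J) @ map (\<lambda>z. [z]) (filter (unmoved ps) (map fst es)),
       ri_arcs = map (\<lambda>a. (fst (source ps (fst a)), snd (source ps (fst a)), source ps (snd a))) es,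
       ri_bound = (if di_bound J < 0 then Suc (Suc (length (di_images J)))
         else Suc (length (di_images J) - nat \<bar>di_bound J\<bar>)) \<rparr>)"

lemma polytime_source:
  assumes "polytime e (enc_list (enc_pair enc_nat enc_nat)) f" "polytime e enc_nat g"
  shows "polytime e (enc_pair enc_nat enc_nat) (\<lambda>x. source (f x) (g x))"
proof -
  have g: "polytime (enc_pair e (enc_pair (enc_pair enc_nat enc_nat) (enc_pair enc_nat enc_nat))) enc_nat
      (\<lambda>y. g (fst y))"
    by (rule polytime_comp[OF _ assms(2)], (rule polytime_fst polytime_id)+)
  let ?c = "tree_size (enc_nat 2)"
  show ?thesis
    unfolding source_def
    by (rule polytime_foldr[OF assms(1), where q="[:?c + 1, 1:]"],
        (rule polytime_if polytime_eq[where ea=enc_nat] inj_enc_nat g polytime_pair assms(2)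
          polytime_fst polytime_snd polytime_id polytime_const)+) auto
qed

lemma polytime_unmoved:
  assumes "polytime e (enc_list (enc_pair enc_nat enc_nat)) f" "polytime e enc_nat g"
  shows "polytime e enc_bool (\<lambda>x. unmoved (f x) (g x))"
proof -
  have g: "polytime (enc_pair e (enc_pair enc_nat enc_nat)) enc_nat (\<lambda>y. g (fst y))"
    by (rule polytime_comp[OF _ assms(2)], (rule polytime_fst polytime_id)+)
  show ?thesis
    unfolding unmoved_def
    by (rule polytime_filter[where ea="enc_pair enc_nat enc_nat"] polytime_if
        polytime_eq[where ea=enc_nat] polytime_eq[where ea="enc_list (enc_pair enc_nat enc_nat)"]
        inj_enc_list inj_enc_pair inj_enc_nat g assms(1)
        polytime_fst polytime_snd polytime_id polytime_const)+
qed

lemma polytime_to_routing: "polytime enc_distance_instance enc_routing_instance to_routing"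
proof -
  let ?J = enc_distance_instance
  let ?ps = "\<lambda>J. concat (di_gens J)" and ?es = "\<lambda>J. List.enumerate 0 (0 # di_images J)"
  have ps: "polytime e (enc_list (enc_pair enc_nat enc_nat)) (\<lambda>x. ?ps (f x))"
    if "polytime e ?J f" for e :: "'a \<Rightarrow> tree" and f
    by (rule polytime_concat polytime_di_gens that)+
  have es: "polytime ?J (enc_list (enc_pair enc_nat enc_nat)) ?es"
    by (rule polytime_enumerate polytime_Cons polytime_const polytime_di_images polytime_id)+
  have classes: "polytime ?J (enc_list (enc_list enc_nat))
      (\<lambda>J. map (map fst) (di_gens J) @ map (\<lambda>z. [z]) (filter (unmoved (?ps J)) (map fst (?es J))))"
    by (rule polytime_append polytime_map polytime_filter polytime_unmoved polytime_Cons ps es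
        polytime_di_gens polytime_fst polytime_snd polytime_id polytime_const)+
  have arcs: "polytime ?J (enc_list (enc_pair enc_nat (enc_pair enc_nat (enc_pair enc_nat enc_nat))))
      (\<lambda>J. map (\<lambda>a. (fst (source (?ps J) (fst a)), snd (source (?ps J) (fst a)), source (?ps J) (snd a))) (?es J))"
    by (rule polytime_map polytime_pair polytime_source ps es
        polytime_fst polytime_snd polytime_id)+
  have bound: "polytime ?J enc_nat (\<lambda>J. if di_bound J < 0 then Suc (Suc (length (di_images J)))
      else Suc (length (di_images J) - nat \<bar>di_bound J\<bar>))"
    by (rule polytime_if polytime_negative polytime_Suc polytime_length_minus polytime_length
        polytime_nat_abs polytime_di_images polytime_di_bound polytime_id)+
  have "polytime ?J (enc_pair (enc_list (enc_list enc_nat))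
    (enc_pair (enc_list (enc_pair enc_nat (enc_pair enc_nat (enc_pair enc_nat enc_nat)))) enc_nat))
      (\<lambda>J. (map (map fst) (di_gens J) @ map (\<lambda>z. [z]) (filter (unmoved (?ps J)) (map fst (?es J))),
        map (\<lambda>a. (fst (source (?ps J) (fst a)), snd (source (?ps J) (fst a)), source (?ps J) (snd a))) (?es J),
        if di_bound J < 0 then Suc (Suc (length (di_images J)))
          else Suc (length (di_images J) - nat \<bar>di_bound J\<bar>)))"
    by (rule polytime_pair classes arcs bound)+
  then show ?thesis
    by (rule polytime_cong) (simp only: enc_routing_instance_def to_routing_def Let_def
      enc_pair.simps routing_instance.simps)
qed


section \<open>Cayley distance and cycles\<close>

text \<open>Fixed points in \<open>S\<close> count as cycles of length 1.\<close>

definition num_cycles :: "'a set \<Rightarrow> ('a \<Rightarrow> 'a) \<Rightarrow> nat" where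
  "num_cycles S p = card (orbit p ` S)"

context
  fixes S :: "'a set" and p :: "'a \<Rightarrow> 'a"
  assumes fin: "finite S" and perm: "p permutes S"
begin

lemma permutation_p: "permutation p"
  using fin perm by (auto simp: permutation_permutes)

lemma orbit_eq_iff: "orbit p x = orbit p y \<longleftrightarrow> x \<in> orbit p y"
  using permutation_self_in_orbit[OF permutation_p] cyclic_on_orbit'[OF permutation_p]
    orbit_cyclic_eq3 by metis

lemma permutes_transpose_comp: "a \<in> S \<Longrightarrow> b \<in> S \<Longrightarrow> transpose a b \<circ> p permutes S"
  by (simp add: perm permutes_compose permutes_swap_id)

text \<open>Along an orbit that avoids \<open>a\<close> and \<open>b\<close>, no value of
  \<open>p\<close> is affected by the transposition.\<close>

lemma orbit_transpose_comp:
  assumes "a \<notin> orbit p x" "b \<notin> orbit p x"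
  shows "orbit (transpose a b \<circ> p) x = orbit p x"
proof (rule orbit_cong)
  show "x \<in> orbit p x" by (rule permutation_self_in_orbit[OF permutation_p])
  fix s assume "s \<in> orbit p x"
  then have "p s \<in> orbit p x" by (rule orbit.step)
  with assms have "p s \<noteq> a" "p s \<noteq> b" by auto
  then show "(transpose a b \<circ> p) s = p s" by (simp add: transpose_def)
qed

lemma num_cycles_le: "num_cycles S p \<le> card S"
  unfolding num_cycles_def by (rule card_image_le[OF fin])

end

text \<open>A new cycle through neither \<open>a\<close> nor \<open>b\<close> is an old cycle other
  than that of \<open>a\<close>; at most two new cycles meet \<open>a\<close> or \<open>b\<close>.
  So the old count minus 1 plus 2 is a bound.\<close>

lemma num_cycles_transpose_le:
  assumes fin: "finite S" and p: "p permutes S" and ab: "a \<in> S" "b \<in> S"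
  shows "num_cycles S (transpose a b \<circ> p) \<le> num_cycles S p + 1"
proof -
  let ?q = "transpose a b \<circ> p"
  have q: "?q permutes S" by (rule permutes_transpose_comp[OF fin p ab])
  have pq: "transpose a b \<circ> ?q = p" by (simp flip: comp_assoc)
  have "orbit ?q ` S \<subseteq> (orbit p ` S - {orbit p a}) \<union> {orbit ?q a, orbit ?q b}"
  proof
    fix O' assume "O' \<in> orbit ?q ` S"
    then obtain x where x: "x \<in> S" "O' = orbit ?q x" by blast
    show "O' \<in> (orbit p ` S - {orbit p a}) \<union> {orbit ?q a, orbit ?q b}"
    proof (cases "a \<in> orbit ?q x \<or> b \<in> orbit ?q x")
      case True
      then show ?thesis using orbit_eq_iff[OF fin q, of a x] orbit_eq_iff[OF fin q, of b x] x by auto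
    next
      case False
      then have "orbit p x = orbit ?q x"
        using orbit_transpose_comp[OF fin q, of a x b] pq by simp
      then show ?thesis using x False orbit_eq_iff[OF fin p, of a x] by auto
    qed
  qed
  then have "card (orbit ?q ` S) \<le> card ((orbit p ` S - {orbit p a}) \<union> {orbit ?q a, orbit ?q b})"
    using fin by (intro card_mono) auto
  also have "\<dots> \<le> card (orbit p ` S - {orbit p a}) + card {orbit ?q a, orbit ?q b}"
    by (rule card_Un_le)
  also have "\<dots> \<le> (card (orbit p ` S) - 1) + 2"
    using ab by (intro add_mono) (simp_all add: card_insert_if)
  also have "\<dots> = card (orbit p ` S) + 1"
    using ab fin card_gt_0_iff[of "orbit p ` S"] by auto
  finally show ?thesis by (simp add: num_cycles_def)
qed

text \<open>The composite sends \<open>a\<close> to itself, so \<open>a\<close> splits off as a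
  fixed point, while \<open>p a\<close> keeps a cycle of its own and all other cycles
  survive.\<close>

lemma num_cycles_cut:
  assumes fin: "finite S" and p: "p permutes S" and a: "p a \<noteq> a"
  shows "num_cycles S p < num_cycles S (transpose a (p a) \<circ> p)"
proof -
  let ?b = "p a"
  let ?q = "transpose a ?b \<circ> p"
  have ab: "a \<in> S" "?b \<in> S" using a p by (metis permutes_not_in, metis permutes_not_in permutes_in_image)
  have q: "?q permutes S" by (rule permutes_transpose_comp[OF fin p ab])
  have qa: "orbit ?q a = {a}" by (simp add: orbit_eq_singleton_iff)
  have bp: "?b \<in> orbit p a" by (rule orbit.base)
  have bq: "?b \<in> orbit ?q ?b" by (rule permutation_self_in_orbit[OF permutation_p[OF fin q]])
  have avoid: "a \<notin> orbit p x" "?b \<notin> orbit p x" if "orbit p x \<noteq> orbit p a" for x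
    using that orbit_eq_iff[OF fin p, of a x] orbit_eq_iff[OF fin p, of ?b x]
      orbit_eq_iff[OF fin p, of ?b a] bp by simp_all
  then have "orbit p x \<in> orbit ?q ` S" if "x \<in> S" "orbit p x \<noteq> orbit p a" for x
    using orbit_transpose_comp[OF fin p] that by blast
  moreover have "{a} \<in> orbit ?q ` S" using ab(1) qa by (metis imageI)
  ultimately have sub: "(orbit p ` S - {orbit p a}) \<union> {{a}, orbit ?q ?b} \<subseteq> orbit ?q ` S"
    using ab by blast
  have disj: "{a} \<notin> orbit p ` S - {orbit p a}" "orbit ?q ?b \<notin> orbit p ` S - {orbit p a}"
    using avoid bq by blast+
  have "{a} \<noteq> orbit ?q ?b" using bq a by auto
  then have "card ((orbit p ` S - {orbit p a}) \<union> {{a}, orbit ?q ?b}) = (card (orbit p ` S) - 1) + 2"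
    using disj fin ab by (simp add: card_insert_if)
  also have "\<dots> = card (orbit p ` S) + 1"
    using ab fin card_gt_0_iff[of "orbit p ` S"] by auto
  finally show ?thesis
    using card_mono[OF _ sub] fin by (simp add: num_cycles_def)
qed

lemma num_cycles_id: "num_cycles S id = card S"
proof -
  have "orbit id x = {x}" for x :: 'a by (simp add: orbit_eq_singleton_iff)
  then have "orbit id ` S = (\<lambda>x. {x}) ` S" by simp
  then show ?thesis unfolding num_cycles_def by (simp add: card_image)
qed

lemma foldr_comp_Cons: "foldr (\<circ>) (f # fs) id = f \<circ> foldr (\<circ>) fs id"
  by simp

lemma foldr_transpositions_permutes:
  "set \<tau>s \<subseteq> transpositions n \<Longrightarrow> foldr (\<circ>) \<tau>s id permutes {1..n}"
proof (induction \<tau>s)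
  case Nil
  then show ?case using permutes_id by (simp add: id_def)
next
  case (Cons \<tau> \<tau>s)
  then obtain a b where "\<tau> = transpose a b" "a \<in> {1..n}" "b \<in> {1..n}"
    by (auto simp: transpositions_def)
  then have "\<tau> permutes {1..n}" by (simp add: permutes_swap_id)
  moreover have "foldr (\<circ>) \<tau>s id permutes {1..n}"
    by (rule Cons.IH) (use Cons.prems in simp)
  ultimately have "\<tau> \<circ> foldr (\<circ>) \<tau>s id permutes {1..n}"
    by (rule permutes_compose[rotated])
  then show ?case by (simp only: foldr_comp_Cons)
qed

text \<open>Lower bound for the distance: the identity has \<open>n\<close> cycles, and each further
  transposition destroys at most one.\<close>

lemma num_cycles_foldr_transpositions:
  "set \<tau>s \<subseteq> transpositions n \<Longrightarrow> n \<le> num_cycles {1..n} (foldr (\<circ>) \<tau>s id) + length \<tau>s"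
proof (induction \<tau>s)
  case Nil
  then show ?case using num_cycles_id[of "{1..n}"] by (simp add: id_def)
next
  case (Cons \<tau> \<tau>s)
  let ?p = "foldr (\<circ>) \<tau>s id"
  obtain a b where ab: "\<tau> = transpose a b" "a \<in> {1..n}" "b \<in> {1..n}"
    using Cons.prems by (auto simp: transpositions_def)
  have p: "?p permutes {1..n}" using Cons.prems by (intro foldr_transpositions_permutes) simp
  \<comment> \<open>A loss of a cycle by \<open>\<tau>\<close> is a gain when \<open>\<tau>\<close>
    is undone, so the bound on gains is applied to \<open>\<tau> \<circ> ?p\<close>.\<close>
  have "num_cycles {1..n} (\<tau> \<circ> (\<tau> \<circ> ?p)) \<le> num_cycles {1..n} (\<tau> \<circ> ?p) + 1"
    unfolding ab(1)
    by (intro num_cycles_transpose_le permutes_transpose_comp p ab finite_atLeastAtMost)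
  moreover have "\<tau> \<circ> (\<tau> \<circ> ?p) = ?p" by (simp add: ab(1) flip: comp_assoc)
  ultimately have "num_cycles {1..n} ?p \<le> num_cycles {1..n} (\<tau> \<circ> ?p) + 1"
    by (simp only:)
  moreover have "n \<le> num_cycles {1..n} ?p + length \<tau>s"
    by (rule Cons.IH) (use Cons.prems in simp)
  ultimately have "n \<le> num_cycles {1..n} (\<tau> \<circ> ?p) + Suc (length \<tau>s)"
    by linarith
  then show ?case by (simp only: foldr_comp_Cons list.size add_Suc_right add_0_right)
qed

text \<open>Upper bound for the distance: as long as some point is moved, cut it off as a fixed
  point and prepend the transposition used.\<close>

lemma obtain_transpositions:
  assumes "p permutes {1..n}"
  shows "\<exists>\<tau>s. length \<tau>s = n - num_cycles {1..n} p \<and> set \<tau>s \<subseteq> transpositions n \<and> foldr (\<circ>) \<tau>s id = p"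
  using assms
proof (induction "n - num_cycles {1..n} p" arbitrary: p rule: less_induct)
  case less
  show ?case
  proof (cases "p = id")
    case True
    then show ?thesis by (intro exI[of _ "[]"]) (simp add: num_cycles_id)
  next
    case False
    then obtain a where a: "p a \<noteq> a" by (auto simp: fun_eq_iff)
    let ?t = "transpose a (p a)"
    have ab: "a \<in> {1..n}" "p a \<in> {1..n}"
      using a less.prems by (metis permutes_not_in, metis permutes_not_in permutes_in_image)
    have q: "?t \<circ> p permutes {1..n}" by (rule permutes_transpose_comp[OF _ less.prems ab]) simp
    have lt: "num_cycles {1..n} p < num_cycles {1..n} (?t \<circ> p)"
      by (rule num_cycles_cut[OF _ less.prems a]) simp
    \<comment> \<open>With \<open>lt\<close> this shows that cutting gains exactly one cycle, which
      makes the length of the list exact.\<close>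
    have "num_cycles {1..n} (?t \<circ> p) \<le> num_cycles {1..n} (?t \<circ> (?t \<circ> p)) + 1"
      using num_cycles_transpose_le[OF _ less.prems ab] by (simp flip: comp_assoc)
    moreover have "num_cycles {1..n} (?t \<circ> p) \<le> n" using num_cycles_le[OF _ q] by simp
    ultimately have eq: "n - num_cycles {1..n} p = Suc (n - num_cycles {1..n} (?t \<circ> p))"
      using lt by (simp flip: comp_assoc)
    then obtain \<tau>s where "length \<tau>s = n - num_cycles {1..n} (?t \<circ> p)"
      "set \<tau>s \<subseteq> transpositions n" "foldr (\<circ>) \<tau>s id = ?t \<circ> p"
      using less.hyps[OF _ q] by auto
    moreover have "?t \<in> transpositions n"
      using a ab unfolding transpositions_def by (intro CollectI exI[of _ a] exI[of _ "p a"]) auto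
    ultimately show ?thesis using eq
      by (intro exI[of _ "?t # \<tau>s"]) (simp flip: comp_assoc)
  qed
qed

lemma cayley_dist_involution:
  assumes "\<eta> \<circ> \<eta> = id" "\<eta> permutes {1..n}" "\<pi> permutes {1..n}"
  shows "cayley_dist n \<eta> \<pi> = n - num_cycles {1..n} (\<eta> \<circ> \<pi>)"
proof -
  have iff: "\<eta> \<circ> f = \<pi> \<longleftrightarrow> f = \<eta> \<circ> \<pi>" for f
    using assms(1) by (metis comp_assoc id_comp)
  have p: "\<eta> \<circ> \<pi> permutes {1..n}" using assms(3,2) by (rule permutes_compose)
  show ?thesis unfolding cayley_dist_def iff
  proof (rule Least_equality)
    show "\<exists>\<tau>s. length \<tau>s = n - num_cycles {1..n} (\<eta> \<circ> \<pi>) \<and> set \<tau>s \<subseteq> transpositions n \<and>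
        foldr (\<circ>) \<tau>s id = \<eta> \<circ> \<pi>"
      by (rule obtain_transpositions[OF p])
    show "n - num_cycles {1..n} (\<eta> \<circ> \<pi>) \<le> m"
      if "\<exists>\<tau>s. length \<tau>s = m \<and> set \<tau>s \<subseteq> transpositions n \<and> foldr (\<circ>) \<tau>s id = \<eta> \<circ> \<pi>" for m
      using that num_cycles_foldr_transpositions by fastforce
  qed
qed


section \<open>Involutions with disjoint support\<close>

abbreviation points :: "(nat \<times> nat) list \<Rightarrow> nat list" where
  "points ps \<equiv> concat (map (\<lambda>(x, y). [x, y]) ps)"

text \<open>Disjoint supports make the order of the factors immaterial, so elements of the subgroup
  are indexed by sets of generators.\<close>

definition selected_product :: "(nat \<times> nat) list list \<Rightarrow> (nat \<times> nat) list set \<Rightarrow> nat \<Rightarrow> nat" where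
  "selected_product \<gamma>s B = involution_of (concat (filter (\<lambda>\<gamma>. \<gamma> \<in> B) \<gamma>s))"

lemma points_mem: "(x, y) \<in> set ps \<Longrightarrow> x \<in> set (points ps) \<and> y \<in> set (points ps)"
  by force

lemma involution_of_append: "involution_of (ps @ qs) = involution_of ps \<circ> involution_of qs"
  unfolding involution_of_def by (induction ps) (auto simp: fun_eq_iff)

lemma involution_of_notin: "z \<notin> set (points ps) \<Longrightarrow> involution_of ps z = z"
  unfolding involution_of_def by (induction ps) (auto simp: transpose_def)

lemma involution_of_mem:
  "distinct (points ps) \<Longrightarrow> (x, y) \<in> set ps \<Longrightarrow> involution_of ps x = y \<and> involution_of ps y = x"
proof (induction ps)
  case (Cons p ps)
  obtain a b where p: "p = (a, b)" by (cases p)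
  have step: "involution_of ((a, b) # ps) z = transpose a b (involution_of ps z)" for z
    by (simp add: involution_of_def)
  show ?case
  proof (cases "(x, y) = p")
    case True
    then have "x \<notin> set (points ps)" "y \<notin> set (points ps)"
      using Cons.prems by (auto simp: p)
    then show ?thesis using True by (auto simp: step involution_of_notin p)
  next
    case False
    then have xy: "(x, y) \<in> set ps" using Cons.prems by auto
    then have "x \<notin> {a, b}" "y \<notin> {a, b}" using Cons.prems(1) points_mem[OF xy] by (auto simp: p)
    then show ?thesis using Cons xy by (auto simp: step transpose_def p)
  qed
qed simp

lemma points_neq: "distinct (points ps) \<Longrightarrow> (x, y) \<in> set ps \<Longrightarrow> x \<noteq> y"
  by (induction ps) auto

lemma selected_product_notin:
  "z \<notin> set (points (concat \<gamma>s)) \<Longrightarrow> selected_product \<gamma>s B z = z"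
  unfolding selected_product_def by (rule involution_of_notin) auto

lemma selected_product_mem:
  assumes "distinct (points (concat \<gamma>s))" "\<gamma> \<in> set \<gamma>s" "(x, y) \<in> set \<gamma>"
  shows "selected_product \<gamma>s B x = (if \<gamma> \<in> B then y else x) \<and>
    selected_product \<gamma>s B y = (if \<gamma> \<in> B then x else y)"
  using assms
proof (induction \<gamma>s)
  case (Cons \<delta> \<gamma>s)
  have step: "selected_product (\<delta> # \<gamma>s) B z =
      (if \<delta> \<in> B then involution_of \<delta> (selected_product \<gamma>s B z) else selected_product \<gamma>s B z)" for z
    by (simp add: selected_product_def involution_of_append)
  have d: "distinct (points \<delta>)" "distinct (points (concat \<gamma>s))"
    "set (points \<delta>) \<inter> set (points (concat \<gamma>s)) = {}"
    using Cons.prems(1) by simp_all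
  show ?case
  proof (cases "\<gamma> \<in> set \<gamma>s")
    case True
    then have "(x, y) \<in> set (concat \<gamma>s)" using Cons.prems by auto
    from points_mem[OF this] have "x \<notin> set (points \<delta>)" "y \<notin> set (points \<delta>)"
      using d(3) by blast+
    then show ?thesis using Cons.IH[OF d(2) True Cons.prems(3)]
      by (simp add: step involution_of_notin)
  next
    case False
    then have g: "\<gamma> = \<delta>" using Cons.prems by simp
    have "x \<notin> set (points (concat \<gamma>s))" "y \<notin> set (points (concat \<gamma>s))"
      using points_mem[OF Cons.prems(3)] d(3) g by blast+
    then show ?thesis using involution_of_mem[OF d(1)] Cons.prems(3) g
      by (simp add: step selected_product_notin)
  qed
qed simp

context
  fixes n :: nat and \<gamma>s :: "(nat \<times> nat) list list"
  assumes disjoint: "disjoint_involutions n \<gamma>s"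
begin

lemma distinct_points: "distinct (points (concat \<gamma>s))"
  and points_subset: "set (points (concat \<gamma>s)) \<subseteq> {1..n}"
  and gens_nonempty: "\<gamma> \<in> set \<gamma>s \<Longrightarrow> \<gamma> \<noteq> []"
  using disjoint by (auto simp: disjoint_involutions_def)

lemma point_cases:
  obtains (notin) "z \<notin> set (points (concat \<gamma>s))"
  | (mem) \<gamma> x y where "\<gamma> \<in> set \<gamma>s" "(x, y) \<in> set \<gamma>" "z = x \<or> z = y"
proof (cases "z \<in> set (points (concat \<gamma>s))")
  case True
  then show ?thesis using mem by fastforce
qed (rule notin)

text \<open>On each pair of a generator two swaps cancel. So the products form an elementary abelian
  2-group under symmetric difference of the index sets.\<close>

lemma selected_product_comp:
  "selected_product \<gamma>s A \<circ> selected_product \<gamma>s B = selected_product \<gamma>s ((A - B) \<union> (B - A))"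
proof
  fix z
  show "(selected_product \<gamma>s A \<circ> selected_product \<gamma>s B) z = selected_product \<gamma>s ((A - B) \<union> (B - A)) z"
  proof (cases z rule: point_cases)
    case notin
    then show ?thesis by (simp add: selected_product_notin)
  next
    case (mem \<gamma> x y)
    show ?thesis using selected_product_mem[OF distinct_points mem(1,2)] mem(3) by auto
  qed
qed

lemma selected_product_empty: "selected_product \<gamma>s {} = id"
  by (simp add: selected_product_def involution_of_def)

lemma selected_product_involution: "selected_product \<gamma>s B \<circ> selected_product \<gamma>s B = id"
  by (simp add: selected_product_comp selected_product_empty)

lemma selected_product_permutes: "selected_product \<gamma>s B permutes {1..n}"
proof -
  have inv: "selected_product \<gamma>s B (selected_product \<gamma>s B z) = z" for z
    using selected_product_involution[of B] by (metis comp_apply id_apply)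
  have "selected_product \<gamma>s B z = z" if "z \<notin> {1..n}" for z
    using that points_subset by (intro selected_product_notin) blast
  then show ?thesis unfolding permutes_def using inv by metis
qed

lemma selected_product_singleton:
  assumes "\<gamma> \<in> set \<gamma>s" shows "selected_product \<gamma>s {\<gamma>} = involution_of \<gamma>"
proof -
  \<comment> \<open>A generator is nonempty, and one of its points cannot recur elsewhere in the
    list; so the filter keeps this single occurrence.\<close>
  obtain \<alpha>s \<beta>s where split: "\<gamma>s = \<alpha>s @ \<gamma> # \<beta>s" using assms by (auto simp: in_set_conv_decomp)
  obtain p where p: "p \<in> set \<gamma>" using gens_nonempty[OF assms] by (cases \<gamma>) auto
  obtain x y where "p = (x, y)" by (cases p)
  then have "(x, y) \<in> set \<gamma>" using p by simp
  from points_mem[OF this] have x: "x \<in> set (points \<gamma>)" by simp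
  have d: "x \<notin> set (points (concat \<alpha>s))" "x \<notin> set (points (concat \<beta>s))"
    using x distinct_points unfolding split concat_append concat.simps map_append distinct_append set_append
    by blast+
  have "(x, y) \<in> set (concat \<delta>s)" if "\<gamma> \<in> set \<delta>s" for \<delta>s
    using that \<open>(x, y) \<in> set \<gamma>\<close> by auto
  then have "\<gamma> \<notin> set \<alpha>s" "\<gamma> \<notin> set \<beta>s"
    using d points_mem by blast+
  then have "filter (\<lambda>\<gamma>'. \<gamma>' \<in> {\<gamma>}) \<alpha>s = []" "filter (\<lambda>\<gamma>'. \<gamma>' \<in> {\<gamma>}) \<beta>s = []"
    by (auto simp: filter_empty_conv)
  then show ?thesis by (simp add: selected_product_def split)
qed

lemma selected_product_in_generate:
  "selected_product \<gamma>s B \<in> generate (sym_group n) (involution_of ` set \<gamma>s)"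
proof -
  have "involution_of (concat \<delta>s) \<in> generate (sym_group n) (involution_of ` set \<gamma>s)"
    if "set \<delta>s \<subseteq> set \<gamma>s" for \<delta>s
    using that
  proof (induction \<delta>s)
    case Nil
    have "involution_of (concat []) = id" by (simp add: involution_of_def)
    then show ?case by (metis generate.one sym_group_one)
  next
    case (Cons \<delta> \<delta>s)
    then have "involution_of \<delta> \<in> generate (sym_group n) (involution_of ` set \<gamma>s)"
      by (intro generate.incl) auto
    moreover have "involution_of (concat \<delta>s) \<in> generate (sym_group n) (involution_of ` set \<gamma>s)"
      by (rule Cons.IH) (use Cons.prems in simp)
    ultimately show ?case
      using generate.eng by (fastforce simp only: concat.simps involution_of_append sym_group_mult)
  qed
  then show ?thesis unfolding selected_product_def by simp
qed

lemma generate_eq_selected_products: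
  "generate (sym_group n) (involution_of ` set \<gamma>s) = selected_product \<gamma>s ` Pow (set \<gamma>s)"
proof
  \<comment> \<open>The induction over \<open>generate\<close> produces an arbitrary index set; it
    is cut down to a set of generators at the end.\<close>
  have restrict: "selected_product \<gamma>s B = selected_product \<gamma>s (B \<inter> set \<gamma>s)" for B
    unfolding selected_product_def by (metis (mono_tags, lifting) IntE IntI filter_cong)
  show "generate (sym_group n) (involution_of ` set \<gamma>s) \<subseteq> selected_product \<gamma>s ` Pow (set \<gamma>s)"
  proof
    fix \<eta> assume "\<eta> \<in> generate (sym_group n) (involution_of ` set \<gamma>s)"
    then have "\<exists>B. \<eta> = selected_product \<gamma>s B"
    proof induction
      case one
      then show ?case using selected_product_empty by (metis sym_group_one)
    next
      case (incl h)
      then show ?case using selected_product_singleton by (metis imageE)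
    next
      case (inv h)
      then obtain \<gamma> where g: "\<gamma> \<in> set \<gamma>s" "h = selected_product \<gamma>s {\<gamma>}"
        using selected_product_singleton by (metis imageE)
      have "inv\<^bsub>sym_group n\<^esub> h = inv' h"
        using selected_product_permutes g by (simp add: sym_group_carrier)
      also have "\<dots> = h" using selected_product_involution g by (metis inv_unique_comp)
      finally show ?case using g by blast
    next
      case (eng h1 h2)
      then show ?case using selected_product_comp by (metis sym_group_mult)
    qed
    then show "\<eta> \<in> selected_product \<gamma>s ` Pow (set \<gamma>s)" using restrict by blast
  qed
  show "selected_product \<gamma>s ` Pow (set \<gamma>s) \<subseteq> generate (sym_group n) (involution_of ` set \<gamma>s)"
    using selected_product_in_generate by blast
qed

text \<open>A generator contains a pair \<open>(x, y)\<close> with \<open>x \<noteq> y\<close>, and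
  the image of \<open>x\<close> reveals whether the generator was selected.\<close>

lemma inj_on_selected_product: "inj_on (selected_product \<gamma>s) (Pow (set \<gamma>s))"
proof (rule inj_onI)
  fix A B assume A: "A \<in> Pow (set \<gamma>s)" and B: "B \<in> Pow (set \<gamma>s)"
    and eq: "selected_product \<gamma>s A = selected_product \<gamma>s B"
  have "\<gamma> \<in> A \<longleftrightarrow> \<gamma> \<in> B" if g: "\<gamma> \<in> set \<gamma>s" for \<gamma>
  proof -
    obtain p where p: "p \<in> set \<gamma>" using gens_nonempty[OF g] by (cases \<gamma>) auto
    obtain x y where xy: "p = (x, y)" by (cases p)
    have "(x, y) \<in> set (concat \<gamma>s)" using g p xy by auto
    from points_neq[OF distinct_points this] have "x \<noteq> y" .
    moreover have "selected_product \<gamma>s C x = (if \<gamma> \<in> C then y else x)" for C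
      using selected_product_mem[OF distinct_points g] p xy by blast
    ultimately show ?thesis using fun_cong[OF eq, of x] by (simp split: if_splits)
  qed
  then show "A = B" using A B by blast
qed

end


section \<open>Routings and products of involutions\<close>

lemma num_cycles_insert_fixed:
  fixes n :: nat
  assumes p: "p permutes {1..n}"
  shows "num_cycles {0..n} p = num_cycles {1..n} p + 1"
proof -
  have "{0..n} = insert 0 {1..n}" by auto
  moreover have "orbit p 0 = {0}" using p by (simp add: orbit_eq_singleton_iff permutes_not_in)
  moreover have "orbit p x \<noteq> {0}" if "x \<in> {1..n}" for x
  proof
    assume "orbit p x = {0}"
    moreover have "x \<in> orbit p x"
      by (rule permutation_self_in_orbit[OF permutation_p[OF finite_atLeastAtMost p]])
    ultimately show False using that by simp
  qed
  then have "{0} \<notin> orbit p ` {1..n}" by blast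
  ultimately show ?thesis by (simp add: num_cycles_def)
qed

lemma orbit_image:
  assumes "e \<in> A" "f \<in> A \<rightarrow> A" "\<And>e. e \<in> A \<Longrightarrow> h (f e) = g (h e)"
  shows "orbit g (h e) = h ` orbit f e"
proof -
  have sub: "z \<in> A" if "z \<in> orbit f e" for z
    using that by induction (use assms(1,2) in auto)
  show ?thesis
  proof
    show "orbit g (h e) \<subseteq> h ` orbit f e"
    proof
      fix y assume "y \<in> orbit g (h e)"
      then show "y \<in> h ` orbit f e"
      proof induction
        case base
        show ?case using assms(3)[OF assms(1)] orbit.base[of f e] by (intro image_eqI[of _ _ "f e"]) simp_all
      next
        case (step y)
        then obtain z where "z \<in> orbit f e" "y = h z" by blast
        then show ?case using assms(3)[OF sub, of z] orbit.step[of z f e] by (intro image_eqI[of _ _ "f z"]) simp_all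
      qed
    qed
    show "h ` orbit f e \<subseteq> orbit g (h e)"
    proof (rule image_subsetI)
      fix z assume "z \<in> orbit f e"
      then show "h z \<in> orbit g (h e)"
      proof induction
        case base
        show ?case using assms(3)[OF assms(1)] orbit.base[of g "h e"] by simp
      next
        case (step y)
        then show ?case using assms(3)[OF sub[OF step(1)]] orbit.step[of "h y" g "h e"] by simp
      qed
    qed
  qed
qed

text \<open>Renaming by \<open>h\<close> carries cycles of \<open>f\<close> to cycles of
  \<open>g\<close>; injectivity on \<open>A\<close> keeps distinct cycles distinct. This transfers
  the count from edges to points.\<close>

lemma num_cycles_image:
  assumes "inj_on h A" "f \<in> A \<rightarrow> A" "\<And>e. e \<in> A \<Longrightarrow> h (f e) = g (h e)"
  shows "num_cycles (h ` A) g = num_cycles A f"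
proof -
  have sub: "z \<in> A" if "z \<in> orbit f e" "e \<in> A" for z e
    using that by induction (use assms(2) in auto)
  have "orbit g ` h ` A = image h ` orbit f ` A"
    using orbit_image[where f=f and g=g and h=h, OF _ assms(2) assms(3)] by (simp add: image_image)
  moreover have "inj_on (image h) (orbit f ` A)"
    using sub by (intro inj_on_subset[OF inj_on_image_Pow[OF assms(1)]]) blast
  ultimately show ?thesis by (simp add: num_cycles_def card_image)
qed

text \<open>\<open>h\<close> names the edges by points, so that the routing without swaps becomes \<open>\<pi>\<close>;
  \<open>q\<close> sends a vertex of valency 2 to the generator that swaps its two outgoing edges.\<close>

locale circuit_encoding =
  fixes G :: "('v, 'e) circuit" and T :: "('v \<times> 'v) set" and h :: "'e \<Rightarrow> nat"
    and n :: nat and \<pi> :: "nat \<Rightarrow> nat" and \<gamma>s :: "(nat \<times> nat) list list"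
    and q :: "'v \<Rightarrow> (nat \<times> nat) list"
  assumes circuit: "switching_circuit G"
    and pol: "polarisation G T"
    and val_le: "v \<in> verts G \<Longrightarrow> valency G v \<le> 2"
    and disjoint: "disjoint_involutions n \<gamma>s"
    and perm: "\<pi> permutes {1..n}"
    and q_range: "q ` {v \<in> verts G. valency G v = 2} = set \<gamma>s"
    and q_eq: "v \<in> verts G \<Longrightarrow> valency G v = 2 \<Longrightarrow> v' \<in> verts G \<Longrightarrow> valency G v' = 2 \<Longrightarrow>
      q v = q v' \<longleftrightarrow> (v, v') \<in> T"
    and pair: "e \<in> edges G \<Longrightarrow> e' \<in> edges G \<Longrightarrow> tail G e = tail G e' \<Longrightarrow>
      out_label G e = 1 \<Longrightarrow> out_label G e' = 2 \<Longrightarrow> (h e, h e') \<in> set (q (tail G e))"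
    and unsupported: "e \<in> edges G \<Longrightarrow> valency G (tail G e) \<noteq> 2 \<Longrightarrow> h e \<notin> set (points (concat \<gamma>s))"
    and inj_h: "inj_on h (edges G)"
    and next_edge: "e \<in> edges G \<Longrightarrow> e' \<in> edges G \<Longrightarrow> tail G e' = head G e \<Longrightarrow>
      out_label G e' = in_label G e \<Longrightarrow> h e' = \<pi> (h e)"
begin

abbreviation binary :: "'v set" where
  "binary \<equiv> {v \<in> verts G. valency G v = 2}"

definition routing_of :: "(nat \<times> nat) list set \<Rightarrow> 'v \<Rightarrow> nat \<Rightarrow> nat" where
  "routing_of B = restrict (\<lambda>v. if v \<in> binary \<and> q v \<in> B then transpose 1 2 else id) (verts G)"

lemma routing_of_binary:
  "v \<in> binary \<Longrightarrow> routing_of B v = (if q v \<in> B then transpose 1 2 else id)"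
  by (simp add: routing_of_def)

lemma routing_of_unary:
  "v \<in> verts G \<Longrightarrow> v \<notin> binary \<Longrightarrow> routing_of B v = id"
  by (auto simp: routing_of_def)

lemma transpose_neq_id: "transpose 1 (2::nat) \<noteq> id"
proof
  assume "transpose 1 (2::nat) = id"
  from fun_cong[OF this, of 1] show False by simp
qed

lemma T_binary: "(x, y) \<in> T \<Longrightarrow> x \<in> verts G \<and> y \<in> verts G \<and> (x \<in> binary \<longleftrightarrow> y \<in> binary)"
  using pol by (fastforce simp: polarisation_def equiv_def refl_on_def)

lemma inj_on_routing_of: "inj_on routing_of (Pow (set \<gamma>s))"
proof (rule inj_onI)
  fix A B assume A: "A \<in> Pow (set \<gamma>s)" and B: "B \<in> Pow (set \<gamma>s)" and eq: "routing_of A = routing_of B"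
  have "q v \<in> A \<longleftrightarrow> q v \<in> B" if "v \<in> binary" for v
    using fun_cong[OF eq, of v] routing_of_binary[OF that] transpose_neq_id by (metis (full_types))
  then have "\<gamma> \<in> A \<longleftrightarrow> \<gamma> \<in> B" if "\<gamma> \<in> set \<gamma>s" for \<gamma>
    using that unfolding q_range[symmetric] by blast
  then show "A = B" using A B by blast
qed

text \<open>A vertex of valency at most 1 admits only the identity, one of valency 2 the identity or
  the swap. Respecting \<open>T\<close> makes this choice one per class, that is, one per
  generator.\<close>

lemma routings_eq:
  "{\<rho> \<in> routings G. respects_polarisation T \<rho>} = routing_of ` Pow (set \<gamma>s)"
proof
  show "routing_of ` Pow (set \<gamma>s) \<subseteq> {\<rho> \<in> routings G. respects_polarisation T \<rho>}"
  proof (rule image_subsetI)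
    fix B
    have "routing_of B \<in> routings G"
      unfolding routings_def
    proof (rule PiE_I)
      fix v assume v: "v \<in> verts G"
      show "routing_of B v \<in> {p. p permutes {1..valency G v}}"
      proof (cases "v \<in> binary")
        case True
        then show ?thesis by (auto simp: routing_of_binary intro: permutes_swap_id permutes_id)
      next
        case False
        then show ?thesis using v by (simp add: routing_of_unary permutes_id)
      qed
    qed (simp add: routing_of_def)
    moreover have "routing_of B x = routing_of B y" if "(x, y) \<in> T" for x y
      using T_binary[OF that] that q_eq[of x y]
      by (cases "x \<in> binary") (auto simp: routing_of_binary routing_of_unary)
    ultimately show "routing_of B \<in> {\<rho> \<in> routings G. respects_polarisation T \<rho>}"
      by (auto simp: respects_polarisation_def)
  qed
  show "{\<rho> \<in> routings G. respects_polarisation T \<rho>} \<subseteq> routing_of ` Pow (set \<gamma>s)"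
  proof
    fix \<rho> assume "\<rho> \<in> {\<rho> \<in> routings G. respects_polarisation T \<rho>}"
    then have \<rho>: "\<rho> \<in> routings G" and resp: "\<And>x y. (x, y) \<in> T \<Longrightarrow> \<rho> x = \<rho> y"
      by (auto simp: respects_polarisation_def)
    \<comment> \<open>By \<open>q_eq\<close>, vertices with the same generator are equivalent and
      hence make the same choice, so \<open>B\<close> determines \<open>\<rho>\<close>.\<close>
    define B where "B = q ` {v \<in> binary. \<rho> v = transpose 1 2}"
    have "\<rho> = routing_of B"
    proof
      fix v
      consider "v \<notin> verts G" | "v \<in> verts G" "v \<notin> binary" | "v \<in> binary" by blast
      then show "\<rho> v = routing_of B v"
      proof cases
        case 1
        then show ?thesis using \<rho> by (auto simp: routings_def routing_of_def PiE_def extensional_def)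
      next
        case 2
        then have "valency G v = 0 \<or> valency G v = 1" using val_le[of v] by force
        then show ?thesis using 2 \<rho> by (auto simp: routings_def routing_of_unary dest!: PiE_mem)
      next
        case 3
        then have "\<rho> v permutes {1..2}" using \<rho> by (auto simp: routings_def dest!: PiE_mem)
        moreover have "{1..2::nat} = {1, 2}" by auto
        ultimately have "\<rho> v = id \<or> \<rho> v = transpose 1 2"
          using permutes_doubleton_iff[of "\<rho> v" 1 2] by simp
        moreover have "q v \<in> B \<longleftrightarrow> \<rho> v = transpose 1 2"
        proof
          assume "q v \<in> B"
          then obtain v' where "v' \<in> binary" "\<rho> v' = transpose 1 2" "q v = q v'"
            by (auto simp: B_def)
          then show "\<rho> v = transpose 1 2" using 3 q_eq[of v v'] resp by auto
        qed (use 3 in \<open>auto simp: B_def\<close>)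
        ultimately show ?thesis using 3 transpose_neq_id by (auto simp: routing_of_binary)
      qed
    qed
    moreover have "B \<in> Pow (set \<gamma>s)" using q_range by (auto simp: B_def)
    ultimately show "\<rho> \<in> routing_of ` Pow (set \<gamma>s)" by blast
  qed
qed

lemma out_edge_unique:
  assumes "v \<in> verts G" "i \<in> {1..valency G v}"
  shows "\<exists>!e'. e' \<in> out_edges G v \<and> out_label G e' = i"
proof -
  have "bij_betw (out_label G) (out_edges G v) {1..valency G v}"
    using circuit assms(1) by (simp add: switching_circuit_def)
  then have inj: "inj_on (out_label G) (out_edges G v)" and im: "i \<in> out_label G ` out_edges G v"
    using assms(2) by (simp_all add: bij_betw_def)
  from im show ?thesis using inj_onD[OF inj] by blast
qed

text \<open>The assumption concerns only the vertex that \<open>e\<close> enters. This admits the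
  constant choices \<open>\<lambda>_. id\<close> and \<open>\<lambda>_. transpose 1 2\<close>, which
  need not be routings, for comparison at one vertex.\<close>

lemma routing_perm_next:
  assumes e: "e \<in> edges G" and B: "\<rho> (head G e) permutes {1..valency G (head G e)}"
  shows "routing_perm G \<rho> e \<in> edges G" "tail G (routing_perm G \<rho> e) = head G e"
    "out_label G (routing_perm G \<rho> e) = \<rho> (head G e) (in_label G e)"
    "in_label G e \<in> {1..valency G (head G e)}" "head G e \<in> verts G"
proof -
  show v: "head G e \<in> verts G" using circuit e by (simp add: switching_circuit_def)
  then have "bij_betw (in_label G) (in_edges G (head G e)) {1..valency G (head G e)}"
    using circuit by (simp add: switching_circuit_def)
  then show l: "in_label G e \<in> {1..valency G (head G e)}"
    using e by (auto simp: bij_betw_def in_edges_def)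
  then have "\<rho> (head G e) (in_label G e) \<in> {1..valency G (head G e)}"
    using permutes_in_image[OF B] by blast
  from theI'[OF out_edge_unique[OF v this]]
  show "routing_perm G \<rho> e \<in> edges G" "tail G (routing_perm G \<rho> e) = head G e"
    "out_label G (routing_perm G \<rho> e) = \<rho> (head G e) (in_label G e)"
    using e by (auto simp: routing_perm_def out_edges_def)
qed

lemma routing_of_permutes:
  "v \<in> verts G \<Longrightarrow> routing_of B v permutes {1..valency G v}"
  by (cases "v \<in> binary") (auto simp: routing_of_binary routing_of_unary intro: permutes_swap_id permutes_id)

text \<open>The straight successor \<open>e0\<close> of \<open>e\<close> is named
  \<open>\<pi> (h e)\<close>. At a vertex of valency 2 the other candidate is \<open>f0\<close>, and
  the two names form a pair of the generator of the vertex, so selecting it exchanges them.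
  Elsewhere \<open>e0\<close> is the only successor and its name is fixed by every
  generator.\<close>

lemma routing_perm_routing_of:
  assumes e: "e \<in> edges G"
  shows "h (routing_perm G (routing_of B) e) = selected_product \<gamma>s B (\<pi> (h e))"
proof -
  let ?v = "head G e"
  have v: "?v \<in> verts G" using circuit e by (simp add: switching_circuit_def)
  define e0 where "e0 = routing_perm G (\<lambda>_. id) e"
  define e1 where "e1 = routing_perm G (routing_of B) e"
  note e0 = routing_perm_next[where \<rho>="\<lambda>_. id", OF e permutes_id, folded e0_def]
  note e1 = routing_perm_next[where \<rho>="routing_of B", OF e routing_of_permutes[OF v], folded e1_def]
  have h0: "h e0 = \<pi> (h e)" using next_edge[OF e e0(1,2)] e0(3) by simp
  have same: "x = y" if "x \<in> edges G" "y \<in> edges G" "tail G x = ?v" "tail G y = ?v"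
    "out_label G x = out_label G y" "out_label G x \<in> {1..valency G ?v}" for x y
    using out_edge_unique[OF v that(6)] that by (auto simp: out_edges_def)
  show ?thesis
  proof (cases "?v \<in> binary")
    case False
    then have "e1 = e0" using e0 e1 v by (intro same) (simp_all add: routing_of_unary)
    moreover have "h e0 \<notin> set (points (concat \<gamma>s))"
      using unsupported[OF e0(1)] e0(2) False v by simp
    ultimately show ?thesis by (simp add: selected_product_notin flip: h0 e1_def)
  next
    case True
    then have val2: "valency G ?v = 2" by simp
    have q: "q ?v \<in> set \<gamma>s" using q_range True by blast
    have two: "in_label G e = 1 \<or> in_label G e = 2" using e0(4) val2 by force
    define f0 where "f0 = routing_perm G (\<lambda>_. transpose 1 2) e"
    have "transpose 1 2 permutes {1..valency G ?v}"
      using val2 by (auto intro: permutes_swap_id)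
    note f0 = routing_perm_next[where \<rho>="\<lambda>_. transpose 1 2", OF e this, folded f0_def]
    have e1': "e1 = (if q ?v \<in> B then f0 else e0)"
      using e0 e1 f0 two val2 by (intro same) (auto simp: routing_of_binary[OF True])
    \<comment> \<open>Which of the two edges has out-label 1 depends on the in-label of
      \<open>e\<close>.\<close>
    have "(h e0, h f0) \<in> set (q ?v) \<or> (h f0, h e0) \<in> set (q ?v)"
      using two pair[OF e0(1) f0(1)] pair[OF f0(1) e0(1)] e0(2,3) f0(2,3) by auto
    then have "selected_product \<gamma>s B (h e0) = (if q ?v \<in> B then h f0 else h e0)"
      using selected_product_mem[OF distinct_points[OF disjoint] q] by blast
    then show ?thesis by (simp add: e1' flip: h0 e1_def)
  qed
qed

lemma card_routing_cycles:
  "card (routing_cycles G (routing_of B)) = num_cycles (h ` edges G) (selected_product \<gamma>s B \<circ> \<pi>)"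
proof -
  have "routing_perm G (routing_of B) \<in> edges G \<rightarrow> edges G"
    using routing_perm_next(1) routing_of_permutes circuit by (auto simp: switching_circuit_def)
  then have "num_cycles (h ` edges G) (selected_product \<gamma>s B \<circ> \<pi>) =
      num_cycles (edges G) (routing_perm G (routing_of B))"
    by (intro num_cycles_image inj_h) (simp_all add: routing_perm_routing_of)
  then show ?thesis by (simp add: num_cycles_def routing_cycles_def)
qed

text \<open>The translation of thresholds is left as an assumption because the edges become
  \<open>{1..n}\<close> in one reduction and \<open>{0..n}\<close>, with one more cycle, in the
  other.\<close>

lemma solutions_correspond:
  assumes bound: "\<And>B. B \<subseteq> set \<gamma>s \<Longrightarrow> K \<le> num_cycles (h ` edges G) (selected_product \<gamma>s B \<circ> \<pi>) \<longleftrightarrow>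
    int (n - num_cycles {1..n} (selected_product \<gamma>s B \<circ> \<pi>)) \<le> D"
  defines "R \<equiv> {\<rho> \<in> routings G. respects_polarisation T \<rho> \<and> K \<le> card (routing_cycles G \<rho>)}"
    and "E \<equiv> {\<eta> \<in> generate (sym_group n) (involution_of ` set \<gamma>s). int (cayley_dist n \<eta> \<pi>) \<le> D}"
  shows "card R = card E \<and> (R \<noteq> {} \<longleftrightarrow> E \<noteq> {})"
proof -
  define \<B> where "\<B> = {B \<in> Pow (set \<gamma>s). K \<le> num_cycles (h ` edges G) (selected_product \<gamma>s B \<circ> \<pi>)}"
  have "R = {\<rho> \<in> routing_of ` Pow (set \<gamma>s). K \<le> card (routing_cycles G \<rho>)}"
    unfolding R_def routings_eq[symmetric] by blast
  also have "\<dots> = routing_of ` \<B>"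
    by (auto simp: \<B>_def card_routing_cycles)
  finally have R: "R = routing_of ` \<B>" .
  have dist: "cayley_dist n (selected_product \<gamma>s B) \<pi> = n - num_cycles {1..n} (selected_product \<gamma>s B \<circ> \<pi>)" for B
    using disjoint perm
    by (intro cayley_dist_involution selected_product_involution selected_product_permutes)
  have E: "E = selected_product \<gamma>s ` \<B>"
    unfolding E_def generate_eq_selected_products[OF disjoint] \<B>_def using bound dist by auto
  have sub: "\<B> \<subseteq> Pow (set \<gamma>s)" by (auto simp: \<B>_def)
  show ?thesis
    unfolding R E using inj_on_subset[OF inj_on_routing_of sub]
      inj_on_subset[OF inj_on_selected_product[OF disjoint] sub] by (simp add: card_image)
qed

end


section \<open>Correctness of the reductions\<close>

lemma classes_disjoint:
  "distinct (concat cs) \<Longrightarrow> C \<in> set cs \<Longrightarrow> C' \<in> set cs \<Longrightarrow> v \<in> set C \<Longrightarrow> v \<in> set C' \<Longrightarrow> C = C'"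
  by (induction cs) auto

lemma distinct_points_map:
  assumes "inj_on f (set (concat (map (\<lambda>v. [(v, 1), (v, 2)]) vs)))" "distinct vs"
  shows "distinct (points (map (\<lambda>v. (f (v, 1::nat), f (v, 2))) vs))"
proof -
  have "distinct (concat (map (\<lambda>v. [(v, 1::nat), (v, 2)]) vs))"
    using assms(2) by (induction vs) auto
  then have "distinct (map f (concat (map (\<lambda>v. [(v, 1), (v, 2)]) vs)))"
    using assms(1) by (simp add: distinct_map)
  moreover have "map f (concat (map (\<lambda>v. [(v, 1), (v, 2)]) vs)) = points (map (\<lambda>v. (f (v, 1), f (v, 2))) vs)"
    by (induction vs) auto
  ultimately show ?thesis by simp
qed

section \<open>The involutions built from a circuit\<close>

context
  fixes w :: nat and I :: routing_instance
  assumes inst: "I \<in> instances (valency2_maximal_routing w)"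
begin

abbreviation "G \<equiv> ri_circuit I"
abbreviation "N \<equiv> length (ri_arcs I)"

lemma I_distinct: "distinct (concat (ri_classes I))"
  and I_circuit: "switching_circuit G"
  and I_pol: "polarisation G (ri_polarisation I)"
  and I_val: "v \<in> verts G \<Longrightarrow> valency G v \<le> 2"
  and I_width: "C \<in> verts G // ri_polarisation I \<Longrightarrow> card C \<le> w"
  using inst by (auto simp: valency2_maximal_routing_def)

lemma I_verts: "verts G = set (concat (ri_classes I))"
  and I_edges: "edges G = {..<N}"
  by (simp_all add: ri_circuit_def)

lemma I_arc: "ri_arcs I ! e = (tail G e, out_label G e, head G e, in_label G e)"
  by (cases "ri_arcs I ! e") (simp add: ri_circuit_def)

lemma length_out_keys: "length (out_keys I) = N"
  and nth_out_keys: "e \<in> edges G \<Longrightarrow> out_keys I ! e = (tail G e, out_label G e)"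
  by (simp_all add: out_keys_def I_edges I_arc)

lemma set_out_keys: "set (out_keys I) = (\<lambda>e. (tail G e, out_label G e)) ` edges G"
proof -
  have "out_keys I = map (\<lambda>e. (tail G e, out_label G e)) [0..<N]"
    by (rule nth_equalityI) (use nth_out_keys in \<open>simp_all add: length_out_keys I_edges\<close>)
  then show ?thesis by (simp add: I_edges lessThan_atLeast0)
qed

lemma tail_in_verts: "e \<in> edges G \<Longrightarrow> tail G e \<in> verts G"
  and head_in_verts: "e \<in> edges G \<Longrightarrow> head G e \<in> verts G"
  using I_circuit by (auto simp: switching_circuit_def)

lemma bij_out: "v \<in> verts G \<Longrightarrow> bij_betw (out_label G) (out_edges G v) {1..valency G v}"
  and bij_in: "v \<in> verts G \<Longrightarrow> bij_betw (in_label G) (in_edges G v) {1..valency G v}"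
  using I_circuit by (auto simp: switching_circuit_def)

lemma out_key_unique:
  assumes "e \<in> edges G" "e' \<in> edges G" "tail G e = tail G e'" "out_label G e = out_label G e'"
  shows "e = e'"
  using bij_out[OF tail_in_verts[OF assms(1)]] assms
  by (auto simp: bij_betw_def out_edges_def dest: inj_onD)

lemma in_key_unique:
  assumes "e \<in> edges G" "e' \<in> edges G" "head G e = head G e'" "in_label G e = in_label G e'"
  shows "e = e'"
  using bij_in[OF head_in_verts[OF assms(1)]] assms
  by (auto simp: bij_betw_def in_edges_def dest: inj_onD)

lemma edge_point_edge:
  assumes e: "e \<in> edges G" shows "edge_point I (tail G e, out_label G e) = Suc e"
proof -
  let ?k = "(tail G e, out_label G e)"
  have k: "?k \<in> set (out_keys I)" using e by (simp add: set_out_keys)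
  let ?p = "position ?k (out_keys I)"
  have p: "?p \<in> edges G" using position_less[OF k] by (simp add: length_out_keys I_edges)
  have "(tail G ?p, out_label G ?p) = ?k"
    using nth_position[OF k] nth_out_keys[OF p] by simp
  then have "?p = e" using out_key_unique[OF p e] by simp
  then show ?thesis by (simp add: edge_point_def)
qed

lemma out_key_iff:
  assumes "v \<in> verts G" shows "(v, i) \<in> set (out_keys I) \<longleftrightarrow> 1 \<le> i \<and> i \<le> valency G v"
proof -
  have "(v, i) \<in> set (out_keys I) \<longleftrightarrow> i \<in> out_label G ` out_edges G v"
    by (auto simp: set_out_keys out_edges_def)
  also have "\<dots> \<longleftrightarrow> i \<in> {1..valency G v}"
    using bij_out[OF assms] by (simp add: bij_betw_def)
  finally show ?thesis by simp
qed

lemma inj_on_edge_point: "inj_on (edge_point I) (set (out_keys I))"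
  by (rule inj_onI) (auto simp: set_out_keys edge_point_edge)

lemma edge_point_range: "k \<in> set (out_keys I) \<Longrightarrow> edge_point I k \<in> {1..N}"
  using position_less[of k "out_keys I"] by (simp add: edge_point_def length_out_keys)

abbreviation "wide \<equiv> \<lambda>v. filter (\<lambda>k. k = (v, 2)) (out_keys I) \<noteq> []"

text \<open>Out-label 2 occurs exactly at valency at least 2, and 2 is the maximum.\<close>

lemma wide_iff: "v \<in> verts G \<Longrightarrow> wide v \<longleftrightarrow> valency G v = 2"
  using out_key_iff[of v 2] I_val[of v] by (auto simp: filter_empty_conv)

abbreviation "wide_verts \<equiv> {v \<in> verts G. valency G v = 2}"

lemma wide_keys: "v \<in> wide_verts \<Longrightarrow> (v, 1) \<in> set (out_keys I) \<and> (v, 2) \<in> set (out_keys I)"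
  by (simp add: out_key_iff)

lemma set_class_involution:
  assumes "C \<in> set (ri_classes I)"
  shows "set (class_involution I C) = (\<lambda>v. (edge_point I (v, 1), edge_point I (v, 2))) ` (set C \<inter> wide_verts)"
proof -
  have "set C \<subseteq> verts G" using assms by (auto simp: I_verts)
  then show ?thesis using wide_iff by (auto simp: class_involution_def)
qed

text \<open>Removing empty generators leaves the concatenation unchanged, so disjointness can be
  checked for all vertices of valency 2 at once, regardless of classes.\<close>

lemma concat_gens:
  "concat (di_gens (to_distance I)) =
    map (\<lambda>v. (edge_point I (v, 1), edge_point I (v, 2))) (filter wide (concat (ri_classes I)))"
proof -
  have "concat (filter (\<lambda>\<gamma>. \<gamma> \<noteq> []) \<gamma>s) = concat \<gamma>s" for \<gamma>s :: "(nat \<times> nat) list list"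
    by (induction \<gamma>s) auto
  then have "concat (di_gens (to_distance I)) = concat (map (class_involution I) (ri_classes I))"
    by (simp add: to_distance_def)
  also have "\<dots> = map (\<lambda>v. (edge_point I (v, 1), edge_point I (v, 2))) (filter wide (concat (ri_classes I)))"
    unfolding class_involution_def by (simp add: map_concat filter_concat comp_def)
  finally show ?thesis .
qed

lemma set_filter_wide: "set (filter wide (concat (ri_classes I))) = wide_verts"
  using wide_iff by (auto simp: I_verts)

lemma disjoint_to_distance: "disjoint_involutions N (di_gens (to_distance I))"
proof -
  let ?vs = "filter wide (concat (ri_classes I))"
  have keys: "set (concat (map (\<lambda>v. [(v, 1), (v, 2)]) ?vs)) \<subseteq> set (out_keys I)"
    using wide_keys set_filter_wide by fastforce
  have "distinct (points (concat (di_gens (to_distance I))))"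
    unfolding concat_gens
    by (rule distinct_points_map[OF inj_on_subset[OF inj_on_edge_point keys]]) (simp add: I_distinct)
  moreover have "set (points (concat (di_gens (to_distance I)))) \<subseteq> {1..N}"
    unfolding concat_gens set_concat set_map set_filter_wide[unfolded set_map]
    using wide_keys edge_point_range set_filter_wide by fastforce
  moreover have "[] \<notin> set (di_gens (to_distance I))" by (simp add: to_distance_def)
  ultimately show ?thesis by (simp add: disjoint_involutions_def)
qed

lemma next_key:
  assumes e: "e \<in> edges G" shows "(head G e, in_label G e) \<in> set (out_keys I)"
proof -
  have "in_label G e \<in> {1..valency G (head G e)}"
    using bij_in[OF head_in_verts[OF e]] e by (auto simp: bij_betw_def in_edges_def)
  then show ?thesis using out_key_iff[OF head_in_verts[OF e]] by simp
qed

lemma di_perm_edge: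
  "e \<in> edges G \<Longrightarrow> di_perm (to_distance I) (Suc e) = edge_point I (head G e, in_label G e)"
  by (simp add: di_perm_def to_distance_def I_edges I_arc)

text \<open>Head and in-label determine an edge, so the map is injective on a finite set that it
  sends into itself.\<close>

lemma di_perm_permutes: "di_perm (to_distance I) permutes {1..N}"
proof -
  let ?p = "di_perm (to_distance I)"
  have S: "{1..N} = Suc ` edges G" by (simp add: I_edges lessThan_atLeast0 image_Suc_atLeastLessThan atLeastLessThanSuc_atLeastAtMost)
  have into: "?p ` {1..N} \<subseteq> {1..N}"
    unfolding S by (auto simp: di_perm_edge) (metis S edge_point_range imageE next_key)
  have "inj_on ?p {1..N}"
    unfolding S
  proof (rule inj_onI)
    fix x y assume "x \<in> Suc ` edges G" "y \<in> Suc ` edges G" and eq: "?p x = ?p y"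
    then obtain e e' where e: "e \<in> edges G" "x = Suc e" "e' \<in> edges G" "y = Suc e'" by blast
    then have "edge_point I (head G e, in_label G e) = edge_point I (head G e', in_label G e')"
      using eq by (simp add: di_perm_edge)
    from inj_onD[OF inj_on_edge_point this next_key[OF e(1)] next_key[OF e(3)]]
    have "(head G e, in_label G e) = (head G e', in_label G e')" .
    then show "x = y" using in_key_unique e by simp
  qed
  then have "bij_betw ?p {1..N} {1..N}"
    using into by (simp add: bij_betw_def endo_inj_surj)
  then show ?thesis
    by (rule bij_imp_permutes) (auto simp: di_perm_def to_distance_def)
qed

definition "vertex_class v = (SOME C. C \<in> set (ri_classes I) \<and> v \<in> set C)"

lemma vertex_class: "v \<in> verts G \<Longrightarrow> vertex_class v \<in> set (ri_classes I) \<and> v \<in> set (vertex_class v)"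
  unfolding vertex_class_def by (rule someI_ex) (auto simp: I_verts)

lemma vertex_class_eq: "C \<in> set (ri_classes I) \<Longrightarrow> v \<in> set C \<Longrightarrow> vertex_class v = C"
  using vertex_class[of v] classes_disjoint[OF I_distinct] by (auto simp: I_verts)

lemma ri_polarisation_iff:
  "v \<in> verts G \<Longrightarrow> (v, v') \<in> ri_polarisation I \<longleftrightarrow> v' \<in> set (vertex_class v)"
  using vertex_class vertex_class_eq by (auto simp: ri_polarisation_def)

text \<open>The pair determines \<open>v\<close> because \<open>edge_point\<close> is injective on
  out-keys. Hence a generator recovers which vertices of valency 2 its class contains.\<close>

lemma wide_in_class_involution:
  assumes v: "v \<in> wide_verts" and C: "C \<in> set (ri_classes I)"
  shows "(edge_point I (v, 1), edge_point I (v, 2)) \<in> set (class_involution I C) \<longleftrightarrow> v \<in> set C"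
proof
  assume "(edge_point I (v, 1), edge_point I (v, 2)) \<in> set (class_involution I C)"
  then obtain u where u: "u \<in> set C" "u \<in> wide_verts" "edge_point I (v, 1) = edge_point I (u, 1)"
    unfolding set_class_involution[OF C] by auto
  then have "(v, 1) = (u, 1::nat)"
    using inj_onD[OF inj_on_edge_point] wide_keys v by blast
  then show "v \<in> set C" using u by simp
next
  assume "v \<in> set C"
  then show "(edge_point I (v, 1), edge_point I (v, 2)) \<in> set (class_involution I C)"
    unfolding set_class_involution[OF C] using v by blast
qed

lemma to_distance_encoding:
  "circuit_encoding G (ri_polarisation I) Suc N (di_perm (to_distance I)) (di_gens (to_distance I))
    (\<lambda>v. class_involution I (vertex_class v))"
proof
  show "(\<lambda>v. class_involution I (vertex_class v)) ` wide_verts = set (di_gens (to_distance I))"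
  proof
    show "(\<lambda>v. class_involution I (vertex_class v)) ` wide_verts \<subseteq> set (di_gens (to_distance I))"
      using vertex_class wide_in_class_involution by (fastforce simp: to_distance_def)
    show "set (di_gens (to_distance I)) \<subseteq> (\<lambda>v. class_involution I (vertex_class v)) ` wide_verts"
    proof
      fix \<gamma> assume "\<gamma> \<in> set (di_gens (to_distance I))"
      then obtain C where C: "C \<in> set (ri_classes I)" "\<gamma> = class_involution I C" "\<gamma> \<noteq> []"
        by (auto simp: to_distance_def)
      then have "set C \<inter> wide_verts \<noteq> {}" using set_class_involution[OF C(1)] by auto
      then show "\<gamma> \<in> (\<lambda>v. class_involution I (vertex_class v)) ` wide_verts"
        using C vertex_class_eq by blast
    qed
  qed
next
  fix v v' assume v: "v \<in> verts G" "valency G v = 2" and v': "v' \<in> verts G" "valency G v' = 2"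
  show "class_involution I (vertex_class v) = class_involution I (vertex_class v') \<longleftrightarrow> (v, v') \<in> ri_polarisation I"
  proof
    assume "class_involution I (vertex_class v) = class_involution I (vertex_class v')"
    then have "v' \<in> set (vertex_class v)"
      using wide_in_class_involution[of v' "vertex_class v"] wide_in_class_involution[of v' "vertex_class v'"]
        vertex_class[OF v(1)] vertex_class[OF v'(1)] v' by simp
    then show "(v, v') \<in> ri_polarisation I" using ri_polarisation_iff[OF v(1)] by simp
  next
    assume "(v, v') \<in> ri_polarisation I"
    then have "v' \<in> set (vertex_class v)" using ri_polarisation_iff[OF v(1)] by simp
    then show "class_involution I (vertex_class v) = class_involution I (vertex_class v')"
      using vertex_class_eq[of "vertex_class v" v'] vertex_class[OF v(1)] by simp
  qed
next
  fix e e' assume e: "e \<in> edges G" "e' \<in> edges G" "tail G e = tail G e'" "out_label G e = 1" "out_label G e' = 2"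
  let ?v = "tail G e"
  have v: "?v \<in> verts G" using e(1) by (rule tail_in_verts)
  have "(?v, 2) \<in> set (out_keys I)" unfolding set_out_keys using e by force
  then have "?v \<in> wide_verts" using out_key_iff[OF v] I_val[OF v] v by simp
  then have "(edge_point I (?v, 1), edge_point I (?v, 2)) \<in> set (class_involution I (vertex_class ?v))"
    using wide_in_class_involution vertex_class[OF v] by blast
  then show "(Suc e, Suc e') \<in> set (class_involution I (vertex_class ?v))"
    using edge_point_edge[OF e(1)] edge_point_edge[OF e(2)] e(3-5) by simp
next
  fix e assume e: "e \<in> edges G" "valency G (tail G e) \<noteq> 2"
  show "Suc e \<notin> set (points (concat (di_gens (to_distance I))))"
  proof
    assume "Suc e \<in> set (points (concat (di_gens (to_distance I))))"
    then obtain v i where v: "v \<in> set (filter wide (concat (ri_classes I)))"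
      and i: "i = 1 \<or> i = 2" "Suc e = edge_point I (v, i)"
      unfolding concat_gens by auto
    have "v \<in> wide_verts" using v unfolding set_filter_wide .
    then have "(tail G e, out_label G e) = (v, i)"
      using inj_onD[OF inj_on_edge_point, of "(tail G e, out_label G e)" "(v, i)"] edge_point_edge[OF e(1)]
        i wide_keys e(1) by (auto simp: set_out_keys)
    then show False using e \<open>v \<in> wide_verts\<close> by simp
  qed
next
  fix e e' assume "e \<in> edges G" "e' \<in> edges G" "tail G e' = head G e" "out_label G e' = in_label G e"
  then show "Suc e' = di_perm (to_distance I) (Suc e)"
    using edge_point_edge[of e'] by (simp add: di_perm_edge)
qed (use I_circuit I_pol I_val disjoint_to_distance di_perm_permutes in auto)

lemma to_distance_instance: "to_distance I \<in> instances (ids_subgroup_distance w)"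
proof -
  have "length \<gamma> \<le> w" if gen: "\<gamma> \<in> set (di_gens (to_distance I))" for \<gamma>
  proof -
    obtain C where C: "C \<in> set (ri_classes I)" "\<gamma> = class_involution I C" "\<gamma> \<noteq> []"
      using gen by (auto simp: to_distance_def)
    then have "C \<noteq> []" by (auto simp: class_involution_def)
    then obtain v where v: "v \<in> set C" using list.set_sel(1) by blast
    then have v': "v \<in> verts G" using C(1) by (auto simp: I_verts)
    \<comment> \<open>The width condition speaks of quotient classes; each is the set of one of the
      listed classes.\<close>
    have "ri_polarisation I `` {v} = set C"
      using ri_polarisation_iff[OF v'] vertex_class_eq[OF C(1) v] by auto
    then have "set C \<in> verts G // ri_polarisation I" using v' by (metis quotientI)
    then have "card (set C) \<le> w" by (rule I_width)
    moreover have "distinct C" using I_distinct C(1) by (simp add: distinct_concat_iff)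
    ultimately have "length C \<le> w" by (simp add: distinct_card)
    then show ?thesis
      unfolding C(2) class_involution_def length_map by (rule le_trans[OF length_filter_le])
  qed
  then show ?thesis
    using disjoint_to_distance di_perm_permutes
    by (simp add: ids_subgroup_distance_def) (simp add: to_distance_def)
qed

lemma to_distance_solutions:
  "card (solutions (valency2_maximal_routing w) I) = card (solutions (ids_subgroup_distance w) (to_distance I)) \<and>
   (solutions (valency2_maximal_routing w) I \<noteq> {} \<longleftrightarrow> solutions (ids_subgroup_distance w) (to_distance I) \<noteq> {})"
proof -
  interpret circuit_encoding G "ri_polarisation I" Suc N "di_perm (to_distance I)" "di_gens (to_distance I)"
    "\<lambda>v. class_involution I (vertex_class v)"
    by (rule to_distance_encoding)
  have S: "Suc ` edges G = {1..N}"
    by (simp add: I_edges lessThan_atLeast0 image_Suc_atLeastLessThan atLeastLessThanSuc_atLeastAtMost)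
  have "ri_bound I \<le> num_cycles (Suc ` edges G) (selected_product (di_gens (to_distance I)) B \<circ> di_perm (to_distance I)) \<longleftrightarrow>
    int (N - num_cycles {1..N} (selected_product (di_gens (to_distance I)) B \<circ> di_perm (to_distance I)))
      \<le> di_bound (to_distance I)" for B
  proof -
    \<comment> \<open>With at most \<open>N\<close> cycles the subtraction is exact. For a bound
      above \<open>N\<close> both sides are false, the right one because \<open>di_bound\<close> is
      then \<open>- 1\<close>.\<close>
    have "num_cycles {1..N} (selected_product (di_gens (to_distance I)) B \<circ> di_perm (to_distance I)) \<le> N"
      using num_cycles_le[of "{1..N}" "selected_product (di_gens (to_distance I)) B \<circ> di_perm (to_distance I)"]
        permutes_compose[OF di_perm_permutes selected_product_permutes[OF disjoint_to_distance]] by simp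
    then show ?thesis unfolding S by (auto simp: to_distance_def)
  qed
  from solutions_correspond[OF this] show ?thesis
    by (simp add: valency2_maximal_routing_def ids_subgroup_distance_def) (simp add: to_distance_def)
qed

end


text \<open>Distinct points make the pairs a matching: no point is both a first and a second member,
  and partners determine each other.\<close>

lemma points_inj:
  "distinct (points ps) \<Longrightarrow> (x, y) \<in> set ps \<Longrightarrow> (x', y') \<in> set ps \<Longrightarrow>
    x \<noteq> y' \<and> (x = x' \<longleftrightarrow> y = y')"
proof (induction ps)
  case (Cons p ps)
  obtain a b where p: "p = (a, b)" by (cases p)
  have ab: "a \<noteq> b" "a \<notin> set (points ps)" "b \<notin> set (points ps)"
    and d: "distinct (points ps)" using Cons.prems(1) by (auto simp: p)
  have mem: "u \<noteq> a \<and> u \<noteq> b \<and> v \<noteq> a \<and> v \<noteq> b" if "(u, v) \<in> set ps" for u v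
    using points_mem[OF that] ab by blast
  show ?case using Cons.prems(2,3) Cons.IH[OF d] mem ab by (auto simp: p)
qed simp

lemma distinct_map_fst_points: "distinct (points ps) \<Longrightarrow> distinct (map fst ps)"
proof (induction ps)
  case (Cons p ps)
  obtain a b where p: "p = (a, b)" by (cases p)
  have "a \<notin> fst ` set ps" using Cons.prems points_mem by (fastforce simp: p)
  then show ?case using Cons by (simp add: p)
qed simp

lemma distinct_of_points: "distinct (points ps) \<Longrightarrow> distinct ps"
  using distinct_map_fst_points distinct_map by blast

lemma source_cases:
  "(\<exists>x. (x, e) \<in> set ps \<and> source ps e = (x, 2)) \<or> (e \<notin> snd ` set ps \<and> source ps e = (e, 1))"
  by (induction ps) (auto simp: source_def)

lemma unmoved_iff: "unmoved ps z \<longleftrightarrow> z \<notin> set (points ps)"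
  by (induction ps) (auto simp: unmoved_def)

lemma equiv_classes:
  assumes "distinct (concat cs)"
  shows "equiv (set (concat cs)) (\<Union>C\<in>set cs. set C \<times> set C)"
proof (rule equivI)
  show "trans (\<Union>C\<in>set cs. set C \<times> set C)"
    using classes_disjoint[OF assms] by (intro transI) fastforce
qed (auto simp: refl_on_def sym_def)

section \<open>The circuit built from disjoint involutions\<close>

context
  fixes w :: nat and J :: distance_instance
  assumes inst: "J \<in> instances (ids_subgroup_distance w)" and w: "0 < w"
begin

abbreviation "H \<equiv> ri_circuit (to_routing J)"
abbreviation "n \<equiv> di_degree J"
abbreviation "\<pi> \<equiv> di_perm J"
definition "ps = concat (di_gens J)"
definition "moved = set (points ps)"
abbreviation "src \<equiv> source ps"

lemma J_length: "length (di_images J) = n"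
  and J_perm: "\<pi> permutes {1..n}"
  and J_disjoint: "disjoint_involutions n (di_gens J)"
  and J_width: "\<gamma> \<in> set (di_gens J) \<Longrightarrow> length \<gamma> \<le> w"
  using inst by (auto simp: ids_subgroup_distance_def)

lemma J_distinct: "distinct (points ps)"
  unfolding ps_def by (rule distinct_points[OF J_disjoint])

lemma in_ps_iff: "p \<in> set ps \<longleftrightarrow> (\<exists>\<gamma>\<in>set (di_gens J). p \<in> set \<gamma>)"
  by (simp add: ps_def)

lemma in_moved: "(x, y) \<in> set ps \<Longrightarrow> x \<in> moved \<and> y \<in> moved"
  unfolding moved_def by (rule points_mem)

lemma movedE:
  assumes "e \<in> moved" obtains x y where "(x, y) \<in> set ps" "e = x \<or> e = y"
  using assms unfolding moved_def by fastforce

lemma moved_subset: "moved \<subseteq> {1..n}"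
  unfolding moved_def ps_def by (rule points_subset[OF J_disjoint])

lemma ps_range: "(x, y) \<in> set ps \<Longrightarrow> x \<in> {1..n} \<and> y \<in> {1..n}"
  using in_moved moved_subset by blast

lemma source_pair:
  assumes "(x, y) \<in> set ps" shows "src x = (x, 1)" "src y = (x, 2)"
proof -
  have "x \<notin> snd ` set ps" using points_inj[OF J_distinct assms] by fastforce
  then show "src x = (x, 1)" using source_cases[of x ps] by force
  show "src y = (x, 2)" using source_cases[of y ps] points_inj[OF J_distinct assms] assms by force
qed

lemma source_unmoved: "z \<notin> moved \<Longrightarrow> src z = (z, 1)"
  using source_cases[of z ps] in_moved[of _ z] by blast

text \<open>Out-label 1 means that the edge carries the name of its start vertex; out-label 2 that
  it is the partner of that point, which is unique.\<close>

lemma source_inj: "src e = src e' \<Longrightarrow> e = e'"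
  using source_cases[of e ps] source_cases[of e' ps] points_inj[OF J_distinct] by fastforce

lemma unmoved_ps_iff: "unmoved ps z \<longleftrightarrow> z \<notin> moved"
  unfolding moved_def by (rule unmoved_iff)

lemma map_fst_points: "map fst (List.enumerate 0 (0 # di_images J)) = [0..<Suc n]"
  by (simp add: J_length del: upt_Suc enumerate_simps)

lemma routing_classes:
  "ri_classes (to_routing J) = map (map fst) (di_gens J) @ map (\<lambda>z. [z]) (filter (unmoved ps) [0..<Suc n])"
  by (simp only: to_routing_def Let_def routing_instance.simps map_fst_points ps_def)

lemma length_arcs: "length (ri_arcs (to_routing J)) = Suc n"
  by (simp add: to_routing_def Let_def J_length)

lemma nth_arcs:
  assumes "e \<le> n"
  shows "ri_arcs (to_routing J) ! e = (fst (src e), snd (src e), src (\<pi> e))"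
proof -
  \<comment> \<open>The prefixed 0 shifts the list so that position \<open>e\<close> holds the image
    of \<open>e\<close>; at position 0 it agrees with \<open>\<pi> 0 = 0\<close>.\<close>
  have "(0 # di_images J) ! e = \<pi> e"
    using assms by (cases e) (auto simp: di_perm_def)
  then show ?thesis
    using assms by (simp add: to_routing_def Let_def J_length nth_enumerate_eq ps_def del: enumerate_simps)
qed

lemma H_edges: "edges H = {0..n}"
  by (auto simp: ri_circuit_def length_arcs)

lemma H_arc:
  assumes "e \<le> n"
  shows "tail H e = fst (src e)" "out_label H e = snd (src e)"
    "head H e = fst (src (\<pi> e))" "in_label H e = snd (src (\<pi> e))"
  using nth_arcs[OF assms] by (simp_all add: ri_circuit_def split: prod.splits)

lemma pi_range: "\<pi> e \<le> n \<longleftrightarrow> e \<le> n"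
  using permutes_in_image[OF J_perm, of e] permutes_not_in[OF J_perm, of e] by fastforce

lemma verts_classes: "verts H = set (concat (ri_classes (to_routing J)))"
  by (simp add: ri_circuit_def)

lemma H_verts: "verts H = fst ` set ps \<union> ({0..n} - moved)"
proof -
  have "concat (map (\<lambda>z. [z]) xs) = xs" for xs :: "nat list" by (induction xs) auto
  then have "set (concat (ri_classes (to_routing J))) = fst ` set ps \<union> {z \<in> {0..n}. unmoved ps z}"
    unfolding routing_classes ps_def by (auto simp del: upt_Suc)
  then show ?thesis unfolding verts_classes unmoved_ps_iff by blast
qed

lemma vertex_cases:
  assumes "v \<in> verts H"
  obtains (pair) y where "(v, y) \<in> set ps" | (single) "v \<le> n" "v \<notin> moved"
  using assms by (auto simp: H_verts)

lemma out_edges_iff: "e \<in> out_edges H v \<longleftrightarrow> e \<le> n \<and> fst (src e) = v"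
  and in_edges_iff: "e \<in> in_edges H v \<longleftrightarrow> e \<le> n \<and> fst (src (\<pi> e)) = v"
  by (auto simp: out_edges_def in_edges_def H_edges H_arc)

lemma out_edges_pair:
  assumes p: "(x, y) \<in> set ps" shows "out_edges H x = {x, y}"
proof -
  have "e = x \<or> e = y" if "fst (src e) = x" for e
    using that source_cases[of e ps] points_inj[OF J_distinct p] p by force
  then have "fst (src e) = x \<longleftrightarrow> e \<in> {x, y}" for e
    using source_pair[OF p] by auto
  moreover have "x \<le> n" "y \<le> n" using ps_range[OF p] by simp_all
  ultimately show ?thesis unfolding set_eq_iff out_edges_iff by blast
qed

lemma out_edges_single:
  assumes "v \<le> n" "v \<notin> moved" shows "out_edges H v = {v}"
proof -
  have "e = v" if "fst (src e) = v" for e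
    using that source_cases[of e ps] in_moved assms by force
  then have "fst (src e) = v \<longleftrightarrow> e \<in> {v}" for e
    using source_unmoved[OF assms(2)] by auto
  then show ?thesis unfolding set_eq_iff out_edges_iff using assms(1) by blast
qed

text \<open>Stated with the number of outgoing edges, since \<open>valency\<close> counts incoming
  ones and the two are identified only afterwards.\<close>

lemma bij_betw_out_label:
  assumes "v \<in> verts H" shows "bij_betw (out_label H) (out_edges H v) {1..card (out_edges H v)}"
  using assms
proof (cases rule: vertex_cases)
  case (pair y)
  have vy: "v \<noteq> y" by (rule points_neq[OF J_distinct pair])
  then have "card {v, y} = 2" by simp
  then have two: "{1..card {v, y}} = {1, 2}" by auto
  have "out_label H v = 1" "out_label H y = 2"
    using source_pair[OF pair] ps_range[OF pair] by (simp_all add: H_arc)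
  then show ?thesis
    unfolding out_edges_pair[OF pair] two using vy by (simp add: bij_betw_def)
next
  case single
  then have "out_label H v = 1" by (simp add: H_arc source_unmoved)
  then show ?thesis unfolding out_edges_single[OF single] by (simp add: bij_betw_def)
qed

text \<open>By construction edge \<open>e\<close> ends where edge \<open>\<pi> e\<close> starts.
  This yields equal in- and out-valencies.\<close>

lemma bij_betw_in_out: "bij_betw \<pi> (in_edges H v) (out_edges H v)"
proof (rule bij_betw_imageI)
  show "inj_on \<pi> (in_edges H v)" using permutes_inj_on[OF J_perm] .
  have "e \<in> \<pi> ` in_edges H v" if e: "e \<in> out_edges H v" for e
  proof -
    have e': "\<pi> (inv' \<pi> e) = e" using permutes_inverses(1)[OF J_perm] .
    then have "inv' \<pi> e \<in> in_edges H v"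
      using e pi_range[of "inv' \<pi> e"] unfolding in_edges_iff out_edges_iff by simp
    then show ?thesis using e' by force
  qed
  then show "\<pi> ` in_edges H v = out_edges H v"
    unfolding set_eq_iff using pi_range in_edges_iff out_edges_iff by blast
qed

lemma H_valency: "valency H v = card (out_edges H v)"
  unfolding valency_def using bij_betw_in_out by (rule bij_betw_same_card)

lemma H_valency_pair: "(v, y) \<in> set ps \<Longrightarrow> valency H v = 2"
  using points_neq[OF J_distinct] by (simp add: H_valency out_edges_pair)

lemma H_valency_single: "v \<le> n \<Longrightarrow> v \<notin> moved \<Longrightarrow> valency H v = 1"
  by (simp add: H_valency out_edges_single)

lemma H_valency_2_iff: "v \<in> verts H \<Longrightarrow> valency H v = 2 \<longleftrightarrow> v \<in> fst ` set ps"
  by (erule vertex_cases) (force simp: H_valency_pair H_valency_single dest: in_moved)+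

lemma source_in_verts:
  assumes "e \<le> n" shows "fst (src e) \<in> verts H"
proof (cases "e \<in> moved")
  case True
  then obtain x y where p: "(x, y) \<in> set ps" "e = x \<or> e = y" by (rule movedE)
  then have "fst (src e) = x" using source_pair[OF p(1)] by auto
  moreover have "x \<in> verts H" unfolding H_verts using p(1) by (metis UnI1 fst_conv imageI)
  ultimately show ?thesis by simp
next
  case False
  then show ?thesis using assms by (simp add: source_unmoved H_verts)
qed

lemma H_circuit: "switching_circuit H"
proof -
  have "bij_betw (in_label H) (in_edges H v) {1..valency H v}" if v: "v \<in> verts H" for v
  proof -
    \<comment> \<open>The in-label of \<open>e\<close> is the out-label of \<open>\<pi> e\<close>,
      so its bijectivity is inherited along \<open>\<pi>\<close>.\<close>
    have "bij_betw (out_label H \<circ> \<pi>) (in_edges H v) {1..valency H v}"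
      using bij_betw_trans[OF bij_betw_in_out bij_betw_out_label[OF v]] by (simp add: H_valency)
    moreover have "(out_label H \<circ> \<pi>) e = in_label H e" if "e \<in> in_edges H v" for e
      using that pi_range by (auto simp: in_edges_iff H_arc)
    ultimately show ?thesis by (metis bij_betw_cong)
  qed
  moreover have "finite (verts H)" by (simp add: ri_circuit_def)
  ultimately show ?thesis
    unfolding switching_circuit_def
    using bij_betw_out_label source_in_verts pi_range bij_betw_same_card[OF bij_betw_in_out]
    by (auto simp: H_edges H_arc H_valency)
qed

lemma distinct_classes: "distinct (concat (ri_classes (to_routing J)))"
proof -
  have "concat (map (\<lambda>z. [z]) xs) = xs" for xs :: "nat list" by (induction xs) auto
  then have "concat (ri_classes (to_routing J)) = map fst ps @ filter (unmoved ps) [0..<Suc n]"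
    unfolding routing_classes by (simp add: map_concat ps_def del: upt_Suc)
  moreover have "fst p \<in> moved" if "p \<in> set ps" for p
    using in_moved[of "fst p" "snd p"] that by simp
  ultimately show ?thesis
    using distinct_map_fst_points[OF J_distinct] by (auto simp: unmoved_ps_iff simp del: upt_Suc)
qed

lemma H_class_cases:
  assumes "C \<in> set (ri_classes (to_routing J))"
  obtains (gen) \<gamma> where "\<gamma> \<in> set (di_gens J)" "C = map fst \<gamma>"
  | (single) z where "z \<le> n" "z \<notin> moved" "C = [z]"
  using assms unfolding routing_classes by (auto simp: unmoved_ps_iff simp del: upt_Suc)

lemma class_valency:
  assumes "C \<in> set (ri_classes (to_routing J))" "x \<in> set C" "y \<in> set C"
  shows "valency H x = valency H y"
  using assms(1)
proof (cases rule: H_class_cases)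
  case (gen \<gamma>)
  have "valency H z = 2" if z: "z \<in> set C" for z
  proof -
    obtain u where "(z, u) \<in> set \<gamma>" using z gen(2) by auto
    then have "(z, u) \<in> set ps" using gen(1) by (auto simp: in_ps_iff)
    then show ?thesis by (rule H_valency_pair)
  qed
  then show ?thesis using assms by simp
qed (use assms in auto)

lemma H_pol: "polarisation H (ri_polarisation (to_routing J))"
proof -
  have "equiv (verts H) (ri_polarisation (to_routing J))"
    unfolding verts_classes ri_polarisation_def by (rule equiv_classes[OF distinct_classes])
  moreover have "valency H x = valency H y" if "(x, y) \<in> ri_polarisation (to_routing J)" for x y
    using that class_valency unfolding ri_polarisation_def by blast
  ultimately show ?thesis unfolding polarisation_def by blast
qed

text \<open>Generators give classes of size at most \<open>w\<close> by assumption; the singleton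
  classes of unmoved points are where \<open>0 < w\<close> enters.\<close>

lemma class_width:
  assumes "A \<in> verts H // ri_polarisation (to_routing J)" shows "card A \<le> w"
proof -
  obtain v where v: "v \<in> verts H" "A = ri_polarisation (to_routing J) `` {v}"
    using assms by (auto elim: quotientE)
  obtain C where C: "C \<in> set (ri_classes (to_routing J))" "v \<in> set C"
    using v(1) by (auto simp: verts_classes)
  have "A = set C"
    unfolding v(2) ri_polarisation_def using classes_disjoint[OF distinct_classes C(1)] C by auto
  moreover have "length C \<le> w"
    using C(1) by (cases rule: H_class_cases) (use J_width w in auto)
  ultimately show ?thesis using card_length[of C] by simp
qed

lemma to_routing_instance: "to_routing J \<in> instances (valency2_maximal_routing w)"
proof -
  have "[] \<notin> set (ri_classes (to_routing J))"
    using gens_nonempty[OF J_disjoint] by (auto elim!: H_class_cases)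
  moreover have "valency H v \<le> 2" if "v \<in> verts H" for v
    using that by (cases rule: vertex_cases) (simp_all add: H_valency_pair H_valency_single)
  moreover have "ri_bound (to_routing J) > 0" by (simp add: to_routing_def Let_def)
  ultimately show ?thesis
    using distinct_classes H_circuit H_pol class_width by (simp add: valency2_maximal_routing_def)
qed

definition "vertex_gen v = (SOME \<gamma>. \<gamma> \<in> set (di_gens J) \<and> v \<in> fst ` set \<gamma>)"

lemma vertex_gen: "v \<in> fst ` set ps \<Longrightarrow> vertex_gen v \<in> set (di_gens J) \<and> v \<in> fst ` set (vertex_gen v)"
  unfolding vertex_gen_def by (rule someI_ex) (force simp: in_ps_iff)

text \<open>A vertex is the first member of only one pair, and no pair occurs in two
  generators.\<close>

lemma vertex_gen_eq:
  assumes "\<gamma> \<in> set (di_gens J)" "(v, y) \<in> set \<gamma>" shows "vertex_gen v = \<gamma>"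
proof -
  have p: "(v, y) \<in> set ps" using assms by (auto simp: in_ps_iff)
  then have "v \<in> fst ` set ps" by force
  note g = vertex_gen[OF this]
  then obtain y' where y': "(v, y') \<in> set (vertex_gen v)" by auto
  then have "(v, y') \<in> set ps" using g by (auto simp: in_ps_iff)
  then have "y' = y" using points_inj[OF J_distinct p] by blast
  then show ?thesis
    using classes_disjoint[OF distinct_of_points[OF J_distinct, unfolded ps_def], of "vertex_gen v" \<gamma> "(v, y)"] g y' assms
    by blast
qed

lemma to_routing_encoding:
  "circuit_encoding H (ri_polarisation (to_routing J)) (\<lambda>e. e) n \<pi> (di_gens J) vertex_gen"
proof
  have "{v \<in> verts H. valency H v = 2} = fst ` set ps"
    using H_valency_2_iff by (auto simp: H_verts)
  moreover have "vertex_gen ` fst ` set ps = set (di_gens J)"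
  proof
    show "set (di_gens J) \<subseteq> vertex_gen ` fst ` set ps"
    proof
      fix \<gamma> assume g: "\<gamma> \<in> set (di_gens J)"
      obtain p where p: "p \<in> set \<gamma>" using gens_nonempty[OF J_disjoint g] list.set_sel(1) by blast
      then have "\<gamma> = vertex_gen (fst p)" using vertex_gen_eq[OF g, of "fst p" "snd p"] by simp
      moreover have "p \<in> set ps" using g p by (auto simp: in_ps_iff)
      ultimately show "\<gamma> \<in> vertex_gen ` fst ` set ps" by blast
    qed
  qed (use vertex_gen in blast)
  ultimately show "vertex_gen ` {v \<in> verts H. valency H v = 2} = set (di_gens J)" by simp
next
  fix v v' assume v: "v \<in> verts H" "valency H v = 2" and v': "v' \<in> verts H" "valency H v' = 2"
  have g: "vertex_gen v \<in> set (di_gens J)" "v \<in> fst ` set (vertex_gen v)"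
    and g': "vertex_gen v' \<in> set (di_gens J)" "v' \<in> fst ` set (vertex_gen v')"
    using v v' H_valency_2_iff vertex_gen by simp_all
  show "vertex_gen v = vertex_gen v' \<longleftrightarrow> (v, v') \<in> ri_polarisation (to_routing J)"
  proof
    assume "vertex_gen v = vertex_gen v'"
    then have "v \<in> set (map fst (vertex_gen v))" "v' \<in> set (map fst (vertex_gen v))" using g g' by simp_all
    moreover have "map fst (vertex_gen v) \<in> set (ri_classes (to_routing J))"
      unfolding routing_classes using g by simp
    ultimately show "(v, v') \<in> ri_polarisation (to_routing J)"
      unfolding ri_polarisation_def by blast
  next
    assume "(v, v') \<in> ri_polarisation (to_routing J)"
    then obtain C where C: "C \<in> set (ri_classes (to_routing J))" "v \<in> set C" "v' \<in> set C"
      by (auto simp: ri_polarisation_def)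
    from C(1) show "vertex_gen v = vertex_gen v'"
    proof (cases rule: H_class_cases)
      case (gen \<gamma>)
      have "vertex_gen u = \<gamma>" if u: "u \<in> set C" for u
      proof -
        obtain y where "(u, y) \<in> set \<gamma>" using u gen(2) by auto
        then show ?thesis by (rule vertex_gen_eq[OF gen(1)])
      qed
      then show ?thesis using C(2,3) by simp
    qed (use C in auto)
  qed
next
  fix e e' assume e: "e \<in> edges H" "e' \<in> edges H" "tail H e = tail H e'" "out_label H e = 1" "out_label H e' = 2"
  let ?v = "tail H e"
  have s: "src e = (?v, 1)" "src e' = (?v, 2)"
    using e by (simp_all add: H_edges H_arc prod_eq_iff)
  \<comment> \<open>Out-label 1 names the first member of a pair, out-label 2 its partner.\<close>
  then have "e = ?v" "(?v, e') \<in> set ps"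
    using source_cases[of e ps] source_cases[of e' ps] by auto
  then obtain \<gamma> where "\<gamma> \<in> set (di_gens J)" "(e, e') \<in> set \<gamma>" by (auto simp: in_ps_iff)
  then show "(e, e') \<in> set (vertex_gen ?v)"
    using vertex_gen_eq \<open>e = ?v\<close> by metis
next
  fix e assume e: "e \<in> edges H" "valency H (tail H e) \<noteq> 2"
  have "e \<notin> moved"
  proof
    assume "e \<in> moved"
    then obtain x y where p: "(x, y) \<in> set ps" "e = x \<or> e = y" by (rule movedE)
    then have "tail H e = x" using source_pair[OF p(1)] e(1) by (auto simp: H_edges H_arc)
    then show False using e(2) H_valency_pair[OF p(1)] by simp
  qed
  then show "e \<notin> set (points (concat (di_gens J)))" unfolding moved_def ps_def .
next
  fix e e' assume "e \<in> edges H" "e' \<in> edges H" "tail H e' = head H e" "out_label H e' = in_label H e"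
  then have "src e' = src (\<pi> e)" by (simp add: H_edges H_arc prod_eq_iff)
  then show "e' = \<pi> e" by (rule source_inj)
next
  show "valency H v \<le> 2" if "v \<in> verts H" for v
    using that by (cases rule: vertex_cases) (simp_all add: H_valency_pair H_valency_single)
qed (use H_circuit H_pol J_disjoint J_perm in auto)

lemma to_routing_solutions:
  "card (solutions (ids_subgroup_distance w) J) = card (solutions (valency2_maximal_routing w) (to_routing J)) \<and>
   (solutions (ids_subgroup_distance w) J \<noteq> {} \<longleftrightarrow> solutions (valency2_maximal_routing w) (to_routing J) \<noteq> {})"
proof -
  interpret circuit_encoding H "ri_polarisation (to_routing J)" "\<lambda>e. e" n \<pi> "di_gens J" vertex_gen
    by (rule to_routing_encoding)
  have "ri_bound (to_routing J) \<le> num_cycles ((\<lambda>e. e) ` edges H) (selected_product (di_gens J) B \<circ> \<pi>) \<longleftrightarrow>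
    int (n - num_cycles {1..n} (selected_product (di_gens J) B \<circ> \<pi>)) \<le> di_bound J" for B
  proof -
    have p: "selected_product (di_gens J) B \<circ> \<pi> permutes {1..n}"
      by (rule permutes_compose[OF J_perm selected_product_permutes[OF J_disjoint]])
    have "num_cycles {1..n} (selected_product (di_gens J) B \<circ> \<pi>) \<le> n"
      using num_cycles_le[OF _ p] by simp
    moreover have "num_cycles ((\<lambda>e. e) ` edges H) (selected_product (di_gens J) B \<circ> \<pi>) =
        num_cycles {1..n} (selected_product (di_gens J) B \<circ> \<pi>) + 1"
      using num_cycles_insert_fixed[OF p] by (simp add: H_edges)
    \<comment> \<open>The loop at 0 raises the count c to c + 1, matching the outer
      \<open>Suc\<close> of the bound; truncation to 1 for a large \<open>di_bound\<close> is
      harmless, as every routing then qualifies. For a negative one the bound is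
      \<open>n + 2\<close>, out of reach since c + 1 is at most \<open>n + 1\<close>.\<close>
    ultimately show ?thesis by (auto simp: to_routing_def Let_def J_length)
  qed
  from solutions_correspond[OF this] show ?thesis
    by (simp add: valency2_maximal_routing_def ids_subgroup_distance_def)
qed

end


theorem theorem7:
  fixes w :: nat
  assumes "w > 0"
  shows "parsimoniously_equivalent (valency2_maximal_routing w) (ids_subgroup_distance w)"
proof -
  have "parsimonious_reduction (valency2_maximal_routing w) (ids_subgroup_distance w) to_distance"
    unfolding parsimonious_reduction_def
  proof (intro conjI ballI)
    show "poly_time_on (instances (valency2_maximal_routing w)) (encode (valency2_maximal_routing w))
        (encode (ids_subgroup_distance w)) to_distance"
      using poly_time_on_polytime[OF polytime_to_distance]
      by (simp add: valency2_maximal_routing_def ids_subgroup_distance_def)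
  qed (use to_distance_instance to_distance_solutions in blast)+
  moreover have "parsimonious_reduction (ids_subgroup_distance w) (valency2_maximal_routing w) to_routing"
    unfolding parsimonious_reduction_def
  proof (intro conjI ballI)
    show "poly_time_on (instances (ids_subgroup_distance w)) (encode (ids_subgroup_distance w))
        (encode (valency2_maximal_routing w)) to_routing"
      using poly_time_on_polytime[OF polytime_to_routing]
      by (simp add: valency2_maximal_routing_def ids_subgroup_distance_def)
  qed (use to_routing_instance[OF _ assms] to_routing_solutions[OF _ assms] in blast)+
  ultimately show ?thesis unfolding parsimoniously_equivalent_def by blast
qed

end
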